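(* Let $G=(V,E)$ be a connected undirected graph without loops or multiple edges (not necessarily finite). Then $G$ is the basis graph of a matroid if and only if $G$ satisfies the following two conditions: (WC) For any edge $uv$ of $G$, the subgraph of $G$ induced by $W_=(u,v)$ contains at most two connected components $W'_=(u,v)$, $W''_=(u,v)$ (which are allowed to be empty), and each of the two walls $$\mathcal W'_{uv}:=\{\,W(u,v)\cup W'_=(u,v),\; W(v,u)\cup W''_=(u,v)\,\},$$ $$\mathcal W''_{uv}:=\{\,W(u,v)\cup W''_=(u,v),\; W(v,u)\cup W'_=(u,v)\,\}$$ consists of complementary convex halfspaces of $G$, i.e. of two convex subsets of $V$ that are disjoint and whose union is $V$. (IC) For any two vertices $u,v$ of $G$ with $d_G(u,v)=2$, the interval $I(u,v)$ induces a square, a pyramid, or a 3-dimensional hyperoctahedron.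
   Context: $d_G(u,v)$ is the length of a shortest $(u,v)$-path in $G$. The interval between $u$ and $v$ is $I(u,v)=\{x\in V: d_G(u,x)+d_G(x,v)=d_G(u,v)\}$. A set $A\subseteq V$ is convex if $I(x,y)\subseteq A$ for all $x,y\in A$. For an edge $uv$ of $G$: $W(u,v)=\{x\in V: d_G(x,u)<d_G(x,v)\}$, $W(v,u)=\{x\in V: d_G(x,v)<d_G(x,u)\}$, and $W_=(u,v)=\{x\in V: d_G(x,u)=d_G(x,v)\}$. The sets $W'_=(u,v)$ and $W''_=(u,v)$ denote the vertex sets of the connected components of the subgraph induced by $W_=(u,v)$: if this subgraph is nonempty and connected, one of them is $W_=(u,v)$ and the other is empty; if $W_=(u,v)=\emptyset$, both are empty. A square is the 4-cycle; a pyramid is the graph of the square pyramid (a 4-cycle plus one vertex adjacent to all four of its vertices); the 3-dimensional hyperoctahedron is the graph of the octahedron, i.e. $K_6$ minus a perfect matching. A matroid on a finite set $\Lambda$ is a collection $\mathcal B$ of subsets of $\Lambda$, called bases, such that for all $A,B\in\mathcal B$ and $i\in A\setminus B$ there exists $j\in B\setminus A$ with $(A\setminus\{i\})\cup\{j\}\in\mathcal B$. The basis graph of a matroid $\mathcal B$ has the bases of $\mathcal B$ as vertices, two bases $A,B$ being adjacent iff $|A\triangle B|=2$. A graph is said to be the basis graph of a matroid if it is isomorphic to such a graph.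
   Formalization: With matroids on finite sets the claim fails for infinite G (the countably infinite complete graph satisfies WC and IC); proved instead: for all connected G with the matroid's ground set allowed to be infinite, and for finite G with a finite ground set. *)

theory Defs
  imports Main
begin

datatype 'a ugraph = UGraph (verts: "'a set") (edges: "'a set set")

definition simple_graph :: "'a ugraph \<Rightarrow> bool" where
  "simple_graph G \<longleftrightarrow> (\<forall>e\<in>edges G. e \<subseteq> verts G \<and> card e = 2)"

definition adj :: "'a ugraph \<Rightarrow> 'a \<Rightarrow> 'a \<Rightarrow> bool" where
  "adj G u v \<longleftrightarrow> {u, v} \<in> edges G"

definition induced_subgraph :: "'a ugraph \<Rightarrow> 'a set \<Rightarrow> 'a ugraph" where
  "induced_subgraph G S = UGraph (verts G \<inter> S) {e \<in> edges G. e \<subseteq> S}"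

definition graph_iso :: "'a ugraph \<Rightarrow> 'b ugraph \<Rightarrow> bool" where
  "graph_iso G H \<longleftrightarrow> (\<exists>f. bij_betw f (verts G) (verts H) \<and>
     (\<forall>x\<in>verts G. \<forall>y\<in>verts G. adj G x y \<longleftrightarrow> adj H (f x) (f y)))"

definition gpath :: "'a ugraph \<Rightarrow> 'a \<Rightarrow> 'a list \<Rightarrow> 'a \<Rightarrow> bool" where
  "gpath G u p v \<longleftrightarrow> p \<noteq> [] \<and> hd p = u \<and> last p = v \<and> distinct p \<and>
     set p \<subseteq> verts G \<and> successively (adj G) p"

definition connected_graph :: "'a ugraph \<Rightarrow> bool" where
  "connected_graph G \<longleftrightarrow> (\<forall>u\<in>verts G. \<forall>v\<in>verts G. \<exists>p. gpath G u p v)"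

definition component_sets :: "'a ugraph \<Rightarrow> 'a set set" where
  "component_sets G = (\<lambda>u. {v. \<exists>p. gpath G u p v}) ` verts G"

text \<open>Length counts edges. The value is meaningful only if some path from \<open>u\<close> to \<open>v\<close> exists.\<close>

definition gdist :: "'a ugraph \<Rightarrow> 'a \<Rightarrow> 'a \<Rightarrow> nat" where
  "gdist G u v = (LEAST n. \<exists>p. gpath G u p v \<and> n = length p - 1)"

definition ginterval :: "'a ugraph \<Rightarrow> 'a \<Rightarrow> 'a \<Rightarrow> 'a set" where
  "ginterval G u v = {x \<in> verts G. gdist G u x + gdist G x v = gdist G u v}"

definition gconvex :: "'a ugraph \<Rightarrow> 'a set \<Rightarrow> bool" where
  "gconvex G A \<longleftrightarrow> A \<subseteq> verts G \<and> (\<forall>x\<in>A. \<forall>y\<in>A. ginterval G x y \<subseteq> A)"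

definition complementary_halfspaces :: "'a ugraph \<Rightarrow> 'a set \<Rightarrow> 'a set \<Rightarrow> bool" where
  "complementary_halfspaces G A B \<longleftrightarrow>
     gconvex G A \<and> gconvex G B \<and> A \<inter> B = {} \<and> A \<union> B = verts G"

definition W_less :: "'a ugraph \<Rightarrow> 'a \<Rightarrow> 'a \<Rightarrow> 'a set" where
  "W_less G u v = {x \<in> verts G. gdist G x u < gdist G x v}"

definition W_eq :: "'a ugraph \<Rightarrow> 'a \<Rightarrow> 'a \<Rightarrow> 'a set" where
  "W_eq G u v = {x \<in> verts G. gdist G x u = gdist G x v}"

text \<open>
  \<open>C1\<close> and \<open>C2\<close> list all components of the subgraph induced by \<open>S\<close>, padded with the empty
  set when there are fewer than two. In particular there are at most two components. Disjointness
  rules out listing a single nonempty component twice. The pair is unique up to order.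
\<close>

definition two_components :: "'a ugraph \<Rightarrow> 'a set \<Rightarrow> 'a set \<Rightarrow> 'a set \<Rightarrow> bool" where
  "two_components G S C1 C2 \<longleftrightarrow>
     component_sets (induced_subgraph G S) = {C1, C2} - {{}} \<and> C1 \<inter> C2 = {}"

definition wall_condition :: "'a ugraph \<Rightarrow> bool" where
  "wall_condition G \<longleftrightarrow>
     (\<forall>u\<in>verts G. \<forall>v\<in>verts G. adj G u v \<longrightarrow>
       (\<exists>C1 C2. two_components G (W_eq G u v) C1 C2 \<and>
          complementary_halfspaces G (W_less G u v \<union> C1) (W_less G v u \<union> C2) \<and>
          complementary_halfspaces G (W_less G u v \<union> C2) (W_less G v u \<union> C1)))"

definition square_graph :: "nat ugraph" where
  "square_graph = UGraph {0..<4} {{0, 1}, {1, 2}, {2, 3}, {3, 0}}"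

definition pyramid_graph :: "nat ugraph" where
  "pyramid_graph = UGraph {0..<5}
     ({{0, 1}, {1, 2}, {2, 3}, {3, 0}} \<union> {{4, 0}, {4, 1}, {4, 2}, {4, 3}})"

definition octahedron_graph :: "nat ugraph" where
  "octahedron_graph = UGraph {0..<6}
     ({e. e \<subseteq> {0..<6} \<and> card e = 2} - {{0, 1}, {2, 3}, {4, 5}})"

definition interval_condition :: "'a ugraph \<Rightarrow> bool" where
  "interval_condition G \<longleftrightarrow>
     (\<forall>u\<in>verts G. \<forall>v\<in>verts G. gdist G u v = 2 \<longrightarrow>
       (let H = induced_subgraph G (ginterval G u v)
        in graph_iso H square_graph \<or> graph_iso H pyramid_graph \<or> graph_iso H octahedron_graph))"

text \<open>
  The ground set \<open>\<Lambda>\<close> is not required to be finite here. Finiteness is a separate condition,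
  because an infinite graph can be the basis graph only of a set system on an infinite ground set.
\<close>

definition matroid :: "'b set \<Rightarrow> 'b set set \<Rightarrow> bool" where
  "matroid \<Lambda> \<B> \<longleftrightarrow> \<B> \<subseteq> Pow \<Lambda> \<and>
     (\<forall>A\<in>\<B>. \<forall>B\<in>\<B>. \<forall>i\<in>A - B. \<exists>j\<in>B - A. (A - {i}) \<union> {j} \<in> \<B>)"

definition basis_graph :: "'b set set \<Rightarrow> 'b set ugraph" where
  "basis_graph \<B> = UGraph \<B> {{A, B} | A B. A \<in> \<B> \<and> B \<in> \<B> \<and> card ((A - B) \<union> (B - A)) = 2}"

text \<open>
  A statement "\<open>G\<close> is a basis graph" quantifies over ground sets, hence over ground types, which
  HOL cannot do inside a formula. For a graph with vertices in \<open>'a\<close>, the ground type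
  \<open>'b + 'a set\<close> with \<open>'b\<close> a free type variable loses nothing: it contains a copy of the arbitrary
  type \<open>'b\<close>, and it is large enough for the converse direction, where the elements of the ground
  set can be taken to be halfspaces of the graph.
\<close>

end

theory Submission
  imports Defs
begin

text \<open>
  If the vertices are bases of a matroid and an edge \<open>uv\<close> exchanges \<open>i\<close> for \<open>j\<close>, then
  \<open>W\<^sub>=(u,v)\<close> splits into the bases containing both elements and those containing neither, and the
  four halfspaces of the two walls are "contains \<open>i\<close>", "avoids \<open>i\<close>", "contains \<open>j\<close>" and "avoids
  \<open>j\<close>".

  Conversely, (WC) makes opposite edges of a square have the same walls, and in a triangle the wall
  that cuts off one vertex is shared by its two edges there. Hence a wall separating the ends of an
  edge is one of the two walls of that edge. The ground set consists of one side of every wall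
  (both sides if the two walls of an edge coincide), chosen such that every edge loses exactly one chosen halfspace and gains exactly one. At a vertex
  \<open>b\<close> this is a proper 2-colouring of the graph whose vertices are the walls near \<open>b\<close> and whose edges
  are the neighbours of \<open>b\<close>. A shortest odd cycle in such a graph becomes shorter by two at a
  suitable neighbour of \<open>b\<close>, and a triangle is impossible since the two components of
  \<open>W\<^sub>=(b,v)\<close> are not adjacent; so a 2-colouring exists, and it extends along triangles and
  squares. The exchange property holds since every halfspace that contains \<open>u\<close> but not \<open>v\<close> can be
  left in the first step of a geodesic from \<open>u\<close> to \<open>v\<close>.
\<close>

subsection \<open>Walls and their transport\<close>

text \<open>Distances are axiomatised because two of them occur: \<open>gdist\<close>, and later the
  number of elements by which two bases differ. \<open>graph_metric_unique\<close> identifies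
  them.\<close>

locale graph_metric =
  fixes V :: "'a set" and d :: "'a \<Rightarrow> 'a \<Rightarrow> nat"
  assumes dist_0: "\<lbrakk>x \<in> V; y \<in> V\<rbrakk> \<Longrightarrow> d x y = 0 \<longleftrightarrow> x = y"
    and dist_commute: "\<lbrakk>x \<in> V; y \<in> V\<rbrakk> \<Longrightarrow> d x y = d y x"
    and dist_triangle: "\<lbrakk>x \<in> V; y \<in> V; z \<in> V\<rbrakk> \<Longrightarrow> d x z \<le> d x y + d y z"
    and dist_step: "\<lbrakk>x \<in> V; y \<in> V; d x y = Suc n\<rbrakk> \<Longrightarrow> \<exists>z\<in>V. d x z = 1 \<and> d z y = n"
begin

definition edge :: "'a \<Rightarrow> 'a \<Rightarrow> bool" where
  "edge x y \<longleftrightarrow> x \<in> V \<and> y \<in> V \<and> d x y = 1"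

definition convex :: "'a set \<Rightarrow> bool" where
  "convex A \<longleftrightarrow> A \<subseteq> V \<and> (\<forall>x\<in>A. \<forall>y\<in>A. \<forall>z\<in>V. d x z + d z y = d x y \<longrightarrow> z \<in> A)"

definition halfspace :: "'a set \<Rightarrow> bool" where
  "halfspace H \<longleftrightarrow> convex H \<and> convex (V - H)"

definition closer :: "'a \<Rightarrow> 'a \<Rightarrow> 'a set" where
  "closer u v = {x \<in> V. d x u < d x v}"

lemma edge_sym: "edge x y \<Longrightarrow> edge y x"
  using dist_commute by (auto simp: edge_def)

lemma edgeD: "edge x y \<Longrightarrow> x \<in> V" "edge x y \<Longrightarrow> y \<in> V" "edge x y \<Longrightarrow> d x y = 1" "edge x y \<Longrightarrow> d y x = 1"
  using dist_commute by (auto simp: edge_def)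

lemma edge_dist_le:
  assumes "edge x y" "z \<in> V"
  shows "d z x \<le> Suc (d z y)" "d z y \<le> Suc (d z x)"
  using dist_triangle[of z x y] dist_triangle[of z y x] assms edgeD[OF assms(1)] by auto

lemma edge_towards:
  assumes "x \<in> V" "y \<in> V" "d x y = Suc n"
  obtains z where "edge x z" "z \<in> V" "d z y = n"
  using dist_step[OF assms] assms(1) by (auto simp: edge_def)

lemma dist_2I:
  assumes "edge x m" "edge m y" "x \<noteq> y" "\<not> edge x y"
  shows "d x y = 2"
proof -
  have "d x y \<le> 2" using dist_triangle[of x m y] edgeD[OF assms(1)] edgeD[OF assms(2)] by auto
  moreover have "d x y \<noteq> 0" "d x y \<noteq> 1"
    using assms(3,4) dist_0[of x y] edgeD(1)[OF assms(1)] edgeD(2)[OF assms(2)] by (auto simp: edge_def)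
  ultimately show ?thesis by auto
qed

lemma halfspace_subset: "halfspace H \<Longrightarrow> H \<subseteq> V"
  by (simp add: halfspace_def convex_def)

lemma halfspace_in:
  "\<lbrakk>halfspace H; z \<in> V; x \<in> H; y \<in> H; d x z + d z y = d x y\<rbrakk> \<Longrightarrow> z \<in> H"
  unfolding halfspace_def convex_def by blast

lemma halfspace_notin:
  "\<lbrakk>halfspace H; x \<in> V; y \<in> V; z \<in> V; x \<notin> H; y \<notin> H; d x z + d z y = d x y\<rbrakk> \<Longrightarrow> z \<notin> H"
  unfolding halfspace_def convex_def by blast

lemma halfspace_mid:
  assumes "halfspace H" "edge x m" "edge m y" "d x y = 2"
  shows "\<lbrakk>x \<in> H; y \<in> H\<rbrakk> \<Longrightarrow> m \<in> H" "\<lbrakk>x \<notin> H; y \<notin> H\<rbrakk> \<Longrightarrow> m \<notin> H"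
  using halfspace_in[OF assms(1), of m x y] halfspace_notin[OF assms(1), of x y m]
    edgeD[OF assms(2)] edgeD[OF assms(3)] assms(4) by auto

text \<open>If \<open>H\<close> separates \<open>u\<close> from \<open>v\<close>, a vertex outside \<open>H\<close> that is closer to \<open>u\<close> would have \<open>u\<close> on
  a geodesic to \<open>v\<close>.\<close>

lemma closer_subset_halfspace:
  assumes "halfspace H" "edge u v" "u \<in> H" "v \<notin> H"
  shows "closer u v \<subseteq> H"
proof
  fix x assume x: "x \<in> closer u v"
  show "x \<in> H"
  proof (rule ccontr)
    assume "x \<notin> H"
    moreover have "d x u + d u v = d x v"
      using x edge_dist_le[OF assms(2), of x] edgeD[OF assms(2)] by (auto simp: closer_def)
    ultimately show False
      using halfspace_notin[OF assms(1), of x v u] x assms edgeD[OF assms(2)] by (auto simp: closer_def)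
  qed
qed

text \<open>Both distances have the same edges, so following a geodesic of either one bounds the
  other from above.\<close>

lemma graph_metric_unique:
  assumes "graph_metric V e" and "\<And>x y. \<lbrakk>x \<in> V; y \<in> V\<rbrakk> \<Longrightarrow> e x y = 1 \<longleftrightarrow> d x y = 1"
    and "x \<in> V" "y \<in> V"
  shows "d x y = e x y"
proof -
  interpret e: graph_metric V e by fact
  have "e x y \<le> d x y" using assms(3)
  proof (induction "d x y" arbitrary: x)
    case 0
    then show ?case using dist_0[of x y] e.dist_0[of x y] assms(4) by auto
  next
    case (Suc n)
    obtain z where z: "edge x z" "z \<in> V" "d z y = n"
      using edge_towards[of x y n] Suc assms(4) by metis
    have "e z y \<le> n" using Suc z by metis
    then show ?case
      using e.dist_triangle[of x z y] z Suc assms(2)[of x z] assms(4) edgeD[OF z(1)] by auto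
  qed
  moreover have "d x y \<le> e x y" using assms(3)
  proof (induction "e x y" arbitrary: x)
    case 0
    then show ?case using dist_0[of x y] e.dist_0[of x y] assms(4) by auto
  next
    case (Suc n)
    obtain z where z: "e.edge x z" "z \<in> V" "e z y = n"
      using e.edge_towards[of x y n] Suc assms(4) by metis
    have "d z y \<le> n" using Suc z by metis
    then show ?case
      using dist_triangle[of x z y] z Suc assms(2)[of x z] assms(4) e.edgeD[OF z(1)] by auto
  qed
  ultimately show ?thesis by simp
qed

end

text \<open>\<open>walls u v\<close> collects the halves containing \<open>u\<close> of the two
  walls of \<open>uv\<close>; it is a singleton when these walls coincide. \<open>walls_cong\<close>
  reflects that the walls are determined by the two sets of strictly closer vertices.\<close>

locale walled_graph = graph_metric +
  fixes walls :: "'a \<Rightarrow> 'a \<Rightarrow> 'a set set"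
  assumes walls_pair: "edge u v \<Longrightarrow>
      \<exists>A B. walls u v = {A, B} \<and> A \<inter> B = closer u v \<and> A \<union> B = V - closer v u"
    and walls_halfspace: "\<lbrakk>edge u v; H \<in> walls u v\<rbrakk> \<Longrightarrow> halfspace H"
    and walls_component: "\<lbrakk>edge u v; H \<in> walls u v; edge x y; d x u = d x v; d y u = d y v; x \<in> H\<rbrakk>
      \<Longrightarrow> y \<in> H"
    and walls_compl: "\<lbrakk>edge u v; H \<in> walls u v\<rbrakk> \<Longrightarrow> V - H \<in> walls v u"
    and walls_cong: "\<lbrakk>edge u v; edge u' v'; closer u v = closer u' v'; closer v u = closer v' u'\<rbrakk>
      \<Longrightarrow> walls u v = walls u' v'"
    and square_or_pyramid: "\<lbrakk>edge u m; edge m v; d u v = 2\<rbrakk> \<Longrightarrow>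
      (\<exists>c. edge u c \<and> edge c v \<and> d m c = 2) \<or>
      (\<exists>a c. edge u a \<and> edge a v \<and> edge u c \<and> edge c v \<and> d a c = 2 \<and> edge m a \<and> edge m c)"
begin

section \<open>Squares and the positioning condition\<close>

lemma wall_sides:
  assumes "edge u v" "H \<in> walls u v"
  shows "closer u v \<subseteq> H" "H \<inter> closer v u = {}" "u \<in> H" "v \<notin> H" "H \<subseteq> V"
proof -
  obtain A B where "walls u v = {A, B}" "A \<inter> B = closer u v" "A \<union> B = V - closer v u"
    using walls_pair[OF assms(1)] by blast
  then show 1: "closer u v \<subseteq> H" and 2: "H \<inter> closer v u = {}" and "H \<subseteq> V"
    using assms(2) by auto
  have "u \<in> closer u v" "v \<in> closer v u"
    using edgeD[OF assms(1)] dist_0[of u u] dist_0[of v v] by (auto simp: closer_def)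
  then show "u \<in> H" "v \<notin> H" using 1 2 by auto
qed

text \<open>The square has cyclic order \<open>a\<close>, \<open>b\<close>, \<open>c\<close>,
  \<open>e\<close>. Every member of \<open>walls a b\<close> contains \<open>e\<close> and misses
  \<open>c\<close>, hence includes \<open>closer e c\<close>; the intersection of these members is
  \<open>closer a b\<close>.\<close>

lemma square_closer_subset:
  assumes "edge a b" "edge b c" "edge c e" "edge e a" "d a c = 2" "d b e = 2"
  shows "closer e c \<subseteq> closer a b"
proof -
  obtain A B where AB: "walls a b = {A, B}" "A \<inter> B = closer a b"
    using walls_pair[OF assms(1)] by blast
  have "closer e c \<subseteq> H" if H: "H \<in> walls a b" for H
  proof (rule closer_subset_halfspace[OF walls_halfspace[OF assms(1) H]])
    show "edge e c" using assms edge_sym by blast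
    have "e \<in> closer a b" "c \<in> closer b a"
      using assms(5,6) edgeD[OF assms(2)] edgeD[OF assms(4)] dist_commute[of b e] dist_commute[of a c]
        edgeD[OF assms(1)] by (auto simp: closer_def)
    then show "e \<in> H" "c \<notin> H" using wall_sides[OF assms(1) H] by auto
  qed
  then have "closer e c \<subseteq> A \<inter> B" using AB(1) by blast
  then show ?thesis using AB(2) by simp
qed

lemma square_closer:
  assumes "edge a b" "edge b c" "edge c e" "edge e a" "d a c = 2" "d b e = 2"
  shows "closer a b = closer e c"
proof -
  have "d e b = 2" "d c a = 2"
    using assms(5,6) edgeD(1)[OF assms(1)] edgeD(1)[OF assms(2)] edgeD(1)[OF assms(3)]
      edgeD(1)[OF assms(4)] dist_commute by simp_all
  then show ?thesis
    using square_closer_subset[of a b c e] square_closer_subset[of e c b a] assms edge_sym by blast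
qed

lemma square_walls:
  assumes "edge a b" "edge b c" "edge c e" "edge e a" "d a c = 2" "d b e = 2"
  shows "walls a b = walls e c"
proof (rule walls_cong)
  show "closer a b = closer e c" using square_closer assms .
  have "d e b = 2" "d c a = 2"
    using assms(5,6) edgeD(1)[OF assms(1)] edgeD(1)[OF assms(2)] edgeD(1)[OF assms(3)]
      edgeD(1)[OF assms(4)] dist_commute by simp_all
  then show "closer b a = closer c e"
    using square_closer[of b a e c] assms edge_sym by blast
qed (use assms edge_sym in auto)

text \<open>Maurer's positioning condition. The differences of the distances from \<open>z\<close>
  along the opposite edges \<open>ab\<close> and \<open>ec\<close> lie between -1 and 1, and by
  \<open>square_closer\<close> they have the same sign.\<close>

lemma positioning:
  assumes "edge a b" "edge b c" "edge c e" "edge e a" "d a c = 2" "d b e = 2" "z \<in> V"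
  shows "d z a + d z c = d z b + d z e"
proof -
  have sq: "d e b = 2" "d c a = 2"
    using assms(5,6) edgeD(1)[OF assms(1)] edgeD(1)[OF assms(2)] edgeD(1)[OF assms(3)]
      edgeD(1)[OF assms(4)] dist_commute by simp_all
  have 1: "z \<in> closer a b \<longleftrightarrow> z \<in> closer e c"
    using square_closer[OF assms(1-6)] by simp
  have 2: "z \<in> closer b a \<longleftrightarrow> z \<in> closer c e"
    using square_closer[of b a e c] assms edge_sym sq by blast
  show ?thesis
    using 1 2 edge_dist_le[OF assms(1), of z] edge_dist_le[OF assms(3), of z] assms(7)
    unfolding closer_def by auto
qed

section \<open>The triangle condition of weakly modular graphs\<close>

lemma common_neighbour_square:
  assumes "edge u m" "edge m v" "d u v = 2"
  obtains a c where "edge u a" "edge a v" "edge u c" "edge c v" "d a c = 2"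
  using square_or_pyramid[OF assms] assms by blast

text \<open>Let \<open>u'\<close> be the next vertex from \<open>u\<close> towards \<open>z\<close>.
  If it is not adjacent to \<open>v\<close>, positioning in a square through \<open>u'\<close> and
  \<open>v\<close> either yields the desired vertex or a vertex \<open>c\<close> at the same
  distance from \<open>z\<close> as \<open>u'\<close>. In the latter case the induction hypothesis
  for \<open>u'c\<close> gives \<open>w\<close>, and a square through \<open>w\<close> and
  \<open>u\<close>, positioned from \<open>v\<close>, contains the common neighbour.\<close>

lemma triangle_condition:
  assumes "edge u v" "z \<in> V" "d z u = Suc k" "d z v = Suc k"
  shows "\<exists>p. edge u p \<and> edge v p \<and> d z p = k"
  using assms
proof (induction k arbitrary: u v)
  case 0
  have "edge u z" "edge v z"
    using 0 dist_commute[of u z] dist_commute[of v z] edgeD[OF 0(1)] by (simp_all add: edge_def)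
  then show ?case using dist_0[of z z] 0(2) by blast
next
  case (Suc k)
  note uv = edgeD[OF Suc.prems(1)]
  have "d u z = Suc (Suc k)" using Suc.prems uv dist_commute by metis
  then obtain u' where u': "edge u u'" "d u' z = Suc k" using edge_towards[of u z] Suc.prems uv by metis
  then have zu': "d z u' = Suc k" using dist_commute edgeD Suc.prems(2) by metis
  show ?case
  proof (cases "edge u' v")
    case True
    then show ?thesis using u' zu' edge_sym by blast
  next
    case False
    have "u' \<noteq> v" using zu' Suc.prems by auto
    then have u'v: "d u' v = 2" using dist_2I[of u' u v] False u' Suc.prems edge_sym by blast
    have vu': "d v u' = 2" using u'v dist_commute edgeD u' Suc.prems(1) by metis
    consider (square) c where "edge u' c" "edge c v" "d u c = 2"
      | (pyramid) a c where "edge u' a" "edge a v" "edge u' c" "edge c v" "d a c = 2" "edge u a" "edge u c"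
      using square_or_pyramid[OF edge_sym[OF u'(1)] Suc.prems(1) u'v] by blast
    then show ?thesis
    proof cases
      case pyramid
      have "d z u' + d z v = d z a + d z c"
        using positioning[of u' a v c z] pyramid u'v Suc.prems edge_sym by blast
      moreover have "d z a \<le> Suc (d z u')" "d z c \<le> Suc (d z u')"
        using edge_dist_le[of u' a z] edge_dist_le[of u' c z] pyramid Suc.prems by auto
      ultimately have "d z a = Suc k \<or> d z c = Suc k" using zu' Suc.prems by auto
      then show ?thesis using pyramid edge_sym by blast
    next
      case square
      have "d z u' + d z v = d z u + d z c"
        using positioning[of u' u v c z] square u'v u' Suc.prems edge_sym by blast
      then have "d z c = Suc k" using zu' Suc.prems by auto
      then obtain w where w: "edge u' w" "edge c w" "d z w = k"
        using Suc.IH[of u' c] square zu' Suc.prems by blast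
      have V: "w \<in> V" "u \<in> V" "v \<in> V" "c \<in> V" using w uv square edgeD by auto
      have "d z u \<le> d z w + d w u" "d z v \<le> d z w + d w v"
        using dist_triangle V Suc.prems(2) by auto
      then have "d w u \<ge> 2" "d w v \<ge> 2" using w Suc.prems by auto
      moreover have "d w u \<le> 2" "d w v \<le> 2"
        using dist_triangle[of w u' u] dist_triangle[of w c v] edgeD[OF w(1)] edgeD[OF w(2)]
          edgeD[OF u'(1)] edgeD[OF square(2)] V by auto
      ultimately have wu: "d w u = 2" "d w v = 2" by auto
      obtain a e where ae: "edge w a" "edge a u" "edge w e" "edge e u" "d a e = 2"
        using common_neighbour_square[OF edge_sym[OF w(1)] edge_sym[OF u'(1)] wu(1)] .
      have "d v w + d v u = d v a + d v e"
        using positioning[of w a u e v] ae wu V edge_sym by blast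
      moreover have "d v w = 2" using wu V dist_commute by auto
      moreover have "d v a \<noteq> 0" "d v e \<noteq> 0"
        using dist_0[of v a] dist_0[of v e] wu V edgeD[OF ae(1)] edgeD[OF ae(3)] by auto
      ultimately have "d v a = 1 \<or> d v e = 1" using uv by auto
      then obtain p where p: "edge w p" "edge p u" "d v p = 1" using ae by blast
      have "d z p \<le> Suc k" using edge_dist_le[OF p(1) Suc.prems(2)] w by auto
      moreover have "d z p \<ge> Suc k" using edge_dist_le[OF p(2) Suc.prems(2)] Suc.prems by auto
      ultimately show ?thesis using p V edge_sym[OF p(2)] edgeD[OF p(2)] by (auto simp: edge_def)
    qed
  qed
qed

text \<open>All vertices of a geodesic from \<open>z\<close> to \<open>p\<close> are equidistant
  from \<open>x\<close> and \<open>y\<close>, so the geodesic stays in one component of the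
  equidistant set. Membership of \<open>z\<close> can thus be read off at \<open>p\<close>.\<close>

lemma wall_constant_on_geodesic:
  assumes "edge x y" "H \<in> walls x y" "edge p x" "edge p y" "z \<in> V"
    "d z p = n" "d z x = Suc n" "d z y = Suc n"
  shows "z \<in> H \<longleftrightarrow> p \<in> H"
  using assms(5-8)
proof (induction n arbitrary: z)
  case 0
  then show ?case using dist_0[of z p] edgeD[OF assms(3)] by auto
next
  case (Suc n)
  obtain z' where z': "edge z z'" "d z' p = n" "z' \<in> V"
    using edge_towards[of z p n] Suc.prems edgeD[OF assms(3)] by metis
  have "d z' x \<le> Suc n" "d z' y \<le> Suc n"
    using edge_dist_le[OF assms(3) z'(3)] edge_dist_le[OF assms(4) z'(3)] z'(2) by auto
  moreover have "d z x \<le> Suc (d z' x)" "d z y \<le> Suc (d z' y)"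
    using dist_triangle[of z z' x] dist_triangle[of z z' y] edgeD[OF z'(1)] edgeD[OF assms(1)] by auto
  ultimately have "d z' x = Suc n" "d z' y = Suc n" using Suc.prems by auto
  then show ?case
    using Suc.IH[OF z'(3,2)] walls_component[OF assms(1,2)] z' edge_sym Suc.prems by metis
qed

text \<open>A vertex of \<open>H\<close> is never closer to \<open>v\<close> than to
  \<open>w\<close>. If it is equidistant from them, it is moved along a geodesic either to
  \<open>u\<close> or to a common neighbour \<open>p\<close> of \<open>u\<close> and
  \<open>v\<close> supplied by the triangle condition, where \<open>H'\<close> is known.\<close>

lemma triangle_wall_subset:
  assumes "edge u v" "edge v w" "edge u w" "H \<in> walls u v" "w \<in> H" "H' \<in> walls w v" "u \<in> H'"
  shows "H \<subseteq> H'"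
proof
  fix z assume z: "z \<in> H"
  note H = wall_sides[OF assms(1,4)]
  have wv: "edge w v" using assms edge_sym by blast
  note H' = wall_sides[OF wv assms(6)]
  have zV: "z \<in> V" using z H by auto
  have le: "d z u \<le> d z v" using z H zV by (force simp: closer_def)
  note hs = walls_halfspace[OF assms(1,4)]
  have cv: "d z w \<le> d z v"
  proof (rule ccontr)
    assume "\<not> ?thesis"
    then have "d z w = Suc (d z v)" using edge_dist_le[OF wv zV] by auto
    then show False
      using halfspace_in[OF hs, of v z w] edgeD[OF assms(2)] z assms(5) H by auto
  qed
  show "z \<in> H'"
  proof (cases "d z w < d z v")
    case True
    then show ?thesis using H' zV by (auto simp: closer_def)
  next
    case False
    then have eq: "d z w = d z v" using cv by auto
    show ?thesis
    proof (cases "d z u < d z v")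
      case True
      then have "d z v = Suc (d z u)" using edge_dist_le[OF assms(1) zV] by auto
      then show ?thesis
        using wall_constant_on_geodesic[OF wv assms(6,3,1) zV] eq assms(7) by auto
    next
      case False
      then have eq': "d z u = d z v" using le by auto
      have "d z v \<noteq> 0" using z H zV dist_0[of z v] edgeD[OF assms(1)] by auto
      then obtain k where k: "d z v = Suc k" using not0_implies_Suc by blast
      obtain p where p: "edge u p" "edge v p" "d z p = k"
        using triangle_condition[OF assms(1) zV] eq' k by auto
      have pH: "p \<in> H"
        using wall_constant_on_geodesic[OF assms(1,4) edge_sym[OF p(1)] edge_sym[OF p(2)] zV p(3)]
          eq' k z by auto
      have "p \<noteq> w" using p k eq by auto
      \<comment> \<open>At distance 2 the vertices \<open>p\<close> and \<open>w\<close> of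
        \<open>H\<close> would have \<open>v\<close> between them, but \<open>v\<close> is outside
        \<open>H\<close>.\<close>
      then have pw: "edge p w"
        using dist_2I[of p v w] halfspace_mid(1)[OF hs, of p v w] pH assms(2,5) H p edge_sym by blast
      have "p \<in> H'"
        using walls_component[OF wv assms(6) p(1)] assms(7) edgeD[OF pw] edgeD[OF p(2)] edgeD[OF assms(3)]
          edgeD[OF assms(1)] by auto
      then show ?thesis
        using wall_constant_on_geodesic[OF wv assms(6) pw edge_sym[OF p(2)] zV p(3)] k eq by auto
    qed
  qed
qed

text \<open>The inclusion lemma applies in both directions, since swapping \<open>u\<close> with
  \<open>w\<close> swaps \<open>H\<close> with the member of \<open>walls w v\<close> that contains
  \<open>u\<close>.\<close>

lemma triangle_wall_in:
  assumes "edge u v" "edge v w" "edge u w" "H \<in> walls u v" "w \<in> H"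
  shows "H \<in> walls w v"
proof -
  have wv: "edge w v" using assms edge_sym by blast
  obtain A B where AB: "walls w v = {A, B}" "A \<union> B = V - closer v w"
    using walls_pair[OF wv] by blast
  have "u \<in> A \<union> B" using AB edgeD[OF assms(1)] edgeD[OF assms(3)] by (auto simp: closer_def)
  then obtain H' where H': "H' \<in> walls w v" "u \<in> H'" using AB by auto
  have "H \<subseteq> H'" using triangle_wall_subset[OF assms H'] .
  moreover have "H' \<subseteq> H"
    using triangle_wall_subset[OF wv edge_sym[OF assms(1)] edge_sym[OF assms(3)] H' assms(4,5)] .
  ultimately show ?thesis using H' by auto
qed

lemma triangle_wall_notin:
  assumes "edge u v" "edge v w" "edge u w" "H \<in> walls u v" "w \<notin> H"
  shows "H \<in> walls u w"
proof -
  have "V - H \<in> walls w u"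
    using triangle_wall_in[of v u w "V - H"] assms edge_sym walls_compl edgeD by blast
  then have "V - (V - H) \<in> walls u w" using walls_compl edge_sym[OF assms(3)] by blast
  then show ?thesis using wall_sides[OF assms(1,4)] by (simp add: double_diff)
qed

section \<open>Walls separating an edge, and geodesics crossing a halfspace\<close>

definition all_walls :: "'a set set" where
  "all_walls = {H. \<exists>u v. edge u v \<and> H \<in> walls u v}"

lemma all_wallsI: "\<lbrakk>edge u v; H \<in> walls u v\<rbrakk> \<Longrightarrow> H \<in> all_walls"
  by (auto simp: all_walls_def)

lemma all_walls_halfspace: "H \<in> all_walls \<Longrightarrow> halfspace H"
  using walls_halfspace by (auto simp: all_walls_def)

lemma all_walls_subset: "H \<in> all_walls \<Longrightarrow> H \<subseteq> V"
  using all_walls_halfspace halfspace_subset by blast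

lemma all_walls_compl: "H \<in> all_walls \<Longrightarrow> V - H \<in> all_walls"
  unfolding all_walls_def using walls_compl edge_sym by blast

lemma triangle_pair:
  assumes "edge u v" "edge v w" "edge u w"
  obtains A B where "walls u v = {A, B}" "w \<in> A" "w \<notin> B"
proof -
  obtain A B where AB: "walls u v = {A, B}" "A \<inter> B = closer u v" "A \<union> B = V - closer v u"
    using walls_pair[OF assms(1)] by blast
  have "w \<in> A \<union> B" "w \<notin> A \<inter> B"
    unfolding AB using edgeD[OF assms(2)] edgeD[OF assms(3)] by (auto simp: closer_def)
  then show thesis using that[of A B] that[of B A] AB(1) by (auto simp: insert_commute)
qed

lemma triangle_not_singleton:
  assumes "edge u v" "edge v w" "edge u w"
  shows "walls u v \<noteq> {H}"
  using triangle_pair[OF assms] by (metis insert_iff singletonD)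

text \<open>Moves a crossing of \<open>H\<close> from the edge \<open>mw\<close> to an edge at
  \<open>u\<close>. In a square through \<open>m\<close>, or for one of the two vertices of a
  pyramid, staying in \<open>H\<close> would force \<open>w\<close> into \<open>H\<close> by
  convexity.\<close>

lemma crossing_corner:
  assumes "halfspace H" "edge u m" "edge m w" "d u w = 2" "m \<in> H" "w \<notin> H"
  obtains c where "edge u c" "edge c w" "c \<notin> H" "d m c = 2 \<or> edge m c"
  using square_or_pyramid[OF assms(2-4)]
proof (elim disjE exE conjE)
  fix c assume c: "edge u c" "edge c w" "d m c = 2"
  then have "c \<notin> H" using halfspace_mid(1)[OF assms(1,3) edge_sym, of c] assms by blast
  then show thesis using that c by blast
next
  fix a c assume *: "edge u a" "edge a w" "edge u c" "edge c w" "d a c = 2" "edge m a" "edge m c"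
  then have "a \<notin> H \<or> c \<notin> H" using halfspace_mid(1)[OF assms(1) *(2) edge_sym, of c] assms by blast
  then show thesis using that * by blast
qed

text \<open>Walk from \<open>u\<close> back to \<open>p\<close>: squares carry both walls of an edge to the opposite edge, and
  triangles carry the one that separates the same vertex.\<close>

lemma wall_of_separated_edge:
  assumes pq: "edge p q" "H \<in> walls p q" and "edge u v" "u \<in> H" "v \<notin> H"
  shows "H \<in> walls u v \<and> (walls p q = {H} \<longrightarrow> walls u v = {H})"
  using assms(3-5)
proof (induction "d u p" arbitrary: u v)
  case 0
  note hs = walls_halfspace[OF pq]
  have "u = p" using 0 dist_0[of u p] edgeD[OF pq(1)] edgeD[OF 0(2)] by auto
  show ?case
  proof (cases "v = q")
    case True
    then show ?thesis using \<open>u = p\<close> pq by auto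
  next
    case False
    have pv: "edge p v" using 0 \<open>u = p\<close> by simp
    have "edge v q"
      using dist_2I[OF edge_sym[OF pv] pq(1) False] halfspace_mid(2)[OF hs edge_sym[OF pv] pq(1)]
        wall_sides(3,4)[OF pq] 0(4) by blast
    then show ?thesis
      using triangle_wall_notin[OF pq(1) edge_sym pv pq(2)] triangle_not_singleton[OF pq(1) edge_sym pv]
        0 \<open>u = p\<close> by blast
  qed
next
  case (Suc k)
  note hs = walls_halfspace[OF pq] and uv = edgeD[OF Suc.prems(1)]
  obtain u' where u': "edge u u'" "u' \<in> V" "d u' p = k"
    using edge_towards[of u p k] Suc(2) uv edgeD[OF pq(1)] by metis
  have "d u u' + d u' p = d u p" using u' Suc(2) edgeD[OF u'(1)] by simp
  then have "u' \<in> H"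
    using halfspace_in[OF hs u'(2), of u p] Suc.prems wall_sides[OF pq] by simp
  have u'u: "edge u' u" using u' edge_sym by blast
  show ?case
  proof (cases "edge u' v")
    case True
    have "H \<in> walls u' v" "walls p q = {H} \<longrightarrow> walls u' v = {H}"
      using Suc(1)[OF u'(3)[symmetric] True \<open>u' \<in> H\<close> Suc.prems(3)] by auto
    then show ?thesis
      using triangle_wall_in[OF True edge_sym[OF Suc.prems(1)] u'u] Suc.prems
        triangle_not_singleton[OF True edge_sym[OF Suc.prems(1)] u'u] by blast
  next
    case False
    have "d u' v = 2" using dist_2I[OF u'u Suc.prems(1) _ False] \<open>u' \<in> H\<close> Suc.prems by blast
    then obtain c where c: "edge u' c" "edge c v" "c \<notin> H" "d u c = 2 \<or> edge u c"
      using crossing_corner[OF hs u'u Suc.prems(1)] Suc.prems by blast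
    have IH: "H \<in> walls u' c" "walls p q = {H} \<longrightarrow> walls u' c = {H}"
      using Suc(1)[OF u'(3)[symmetric] c(1) \<open>u' \<in> H\<close> c(3)] by auto
    show ?thesis
    proof (cases "edge u c")
      case True
      have "H \<in> walls u c"
        using triangle_wall_in[OF c(1) edge_sym[OF True] u'u IH(1)] Suc.prems by blast
      then have "H \<in> walls u v"
        using triangle_wall_notin[OF True c(2) Suc.prems(1)] Suc.prems by blast
      then show ?thesis using triangle_not_singleton[OF c(1) edge_sym[OF True] u'u] IH(2) by blast
    next
      case False
      then have "d c u = 2" using c uv dist_commute[of u c] edgeD[OF c(2)] by auto
      then have "walls u' c = walls u v"
        using square_walls[OF c(1,2) edge_sym[OF Suc.prems(1)] u'(1)] \<open>d u' v = 2\<close> by blast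
      then show ?thesis using IH by simp
    qed
  qed
qed

lemma separating_wall:
  assumes "H \<in> all_walls" "edge u v" "u \<in> H" "v \<notin> H"
  shows "H \<in> walls u v"
  using assms wall_of_separated_edge unfolding all_walls_def by blast

text \<open>If the first step of a geodesic does not leave \<open>H\<close>, the crossing found
  after it by induction is pulled back to \<open>u\<close> with \<open>crossing_corner\<close>. This
  is the source of the exchange property.\<close>

lemma geodesic_crossing:
  assumes "halfspace H" "u \<in> V" "v \<in> V" "u \<in> H" "v \<notin> H"
  shows "\<exists>w. edge u w \<and> w \<notin> H \<and> d u v = Suc (d w v)"
  using assms(2,4)
proof (induction "d u v" arbitrary: u)
  case 0
  then show ?case using dist_0[of u v] assms by auto
next
  case (Suc k)
  obtain m where m: "edge u m" "m \<in> V" "d m v = k"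
    using edge_towards[of u v k] Suc assms by metis
  show ?case
  proof (cases "m \<in> H")
    case False
    then show ?thesis using m Suc(2) by auto
  next
    case True
    then obtain w where w: "edge m w" "w \<notin> H" "d m v = Suc (d w v)" using Suc(1) m by blast
    \<comment> \<open>Two successive steps bring the path nearer to \<open>v\<close>, so
      \<open>w\<close> has distance exactly 2 from \<open>u\<close>.\<close>
    have "d u v \<le> d u w + d w v" using dist_triangle[of u w v] edgeD[OF w(1)] Suc assms by auto
    then have "d u w \<noteq> 0" "d u w \<noteq> 1" using m(3) w(3) Suc(2) by auto
    then have "u \<noteq> w" "\<not> edge u w" using dist_0[of u w] edgeD[OF w(1)] Suc by (auto simp: edge_def)
    then have "d u w = 2" using dist_2I[OF m(1) w(1)] by blast
    then obtain c where c: "edge u c" "edge c w" "c \<notin> H"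
      using crossing_corner[OF assms(1) m(1) w(1)] True w by blast
    have "d c v \<le> Suc (d w v)"
      using dist_triangle[of c w v] edgeD[OF c(2)] assms by auto
    moreover have "d u v \<le> Suc (d c v)"
      using dist_triangle[of u c v] edgeD[OF c(1)] assms by auto
    ultimately show ?thesis using c m(3) w(3) Suc(2) by (intro exI[of _ c]) auto
  qed
qed

text \<open>The shared wall is the one cutting \<open>b\<close> off from both \<open>v\<close> and
  \<open>w\<close>. Together with \<open>shared_wall_edge\<close>, two distinct neighbours of
  \<open>b\<close> are adjacent exactly when their edges to \<open>b\<close> share a wall.\<close>

lemma neighbours_share_wall:
  assumes "edge b v" "edge b w" "edge v w"
  shows "\<exists>A. A \<in> walls b v \<and> A \<in> walls b w"
proof -
  obtain A B where AB: "walls b v = {A, B}" "w \<in> A" "w \<notin> B"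
    using triangle_pair[OF assms(1,3,2)] .
  then show ?thesis using triangle_wall_notin[OF assms(1,3,2), of B] by auto
qed

lemma shared_wall_not_dist_2:
  assumes "edge b v" "edge b w" "A \<in> walls b v" "A \<in> walls b w"
  shows "d v w \<noteq> 2"
  using halfspace_mid(2)[OF walls_halfspace[OF assms(1,3)] edge_sym[OF assms(1)] assms(2)]
    wall_sides[OF assms(1,3)] wall_sides[OF assms(2,4)] by blast

lemma shared_wall_edge:
  assumes "edge b v" "edge b w" "A \<in> walls b v" "A \<in> walls b w" "v \<noteq> w"
  shows "edge v w"
  using shared_wall_not_dist_2[OF assms(1-4)] dist_2I[OF edge_sym[OF assms(1)] assms(2,5)] by blast

end

subsection \<open>Links have no odd cycles\<close>

lemma relpow_path:
  assumes "\<And>i. i < n \<Longrightarrow> (f i, f (Suc i)) \<in> R" "i \<le> j" "j \<le> n"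
  shows "(f i, f j) \<in> R ^^ (j - i)"
  unfolding relpow_fun_conv
  by (rule exI[of _ "\<lambda>k. f (i + k)"]) (use assms in auto)

lemma sym_relpow:
  assumes "sym R"
  shows "sym (R ^^ n)"
proof (induction n)
  case (Suc n)
  show ?case
  proof (rule symI)
    fix x y assume "(x, y) \<in> R ^^ Suc n"
    then obtain z where "(x, z) \<in> R ^^ n" "(z, y) \<in> R" by auto
    then have "(y, z) \<in> R" "(z, x) \<in> R ^^ n" using assms Suc by (auto dest: symD)
    then show "(y, x) \<in> R ^^ Suc n" by (rule relpow_Suc_I2)
  qed
qed (auto simp: sym_def)

text \<open>The colour is the parity of a walk to a chosen root of the component; two walks of
  different parity would close up to an odd closed walk.\<close>

lemma two_colouring:
  assumes "sym R" and odd: "\<And>x n. odd n \<Longrightarrow> (x, x) \<notin> R ^^ n"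
  shows "\<exists>c :: 'a \<Rightarrow> bool. \<forall>(x, y)\<in>R. c x \<noteq> c y"
proof -
  define root where "root x = (SOME y. (x, y) \<in> R\<^sup>*)" for x
  define c where "c x \<longleftrightarrow> (\<exists>n. even n \<and> (x, root x) \<in> R ^^ n)" for x
  have "c x \<noteq> c y" if xy: "(x, y) \<in> R" for x y
  proof -
    have yx: "(y, x) \<in> R" using xy \<open>sym R\<close> by (meson symE)
    \<comment> \<open>Connected vertices have the same set of candidates for the root, so the choice
      operator picks the same one.\<close>
    have "(x, z) \<in> R\<^sup>* \<longleftrightarrow> (y, z) \<in> R\<^sup>*" for z
      using xy yx converse_rtrancl_into_rtrancl by metis
    then have root: "root x = root y" by (simp add: root_def)
    have "(x, root x) \<in> R\<^sup>*" unfolding root_def by (rule someI[of _ x]) simp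
    then obtain n where n: "(x, root x) \<in> R ^^ n" using rtrancl_imp_relpow by blast
    then have Suc_n: "(y, root y) \<in> R ^^ Suc n"
      using relpow_Suc_I2[OF yx] root by simp
    have "\<not> (c x \<and> c y)"
    proof
      assume "c x \<and> c y"
      then obtain i j where ij: "even i" "even j" "(x, root x) \<in> R ^^ i" "(y, root x) \<in> R ^^ j"
        using root by (auto simp: c_def)
      have "(root x, y) \<in> R ^^ j" using sym_relpow[OF \<open>sym R\<close>] ij(4) by (meson symE)
      then have "(root x, x) \<in> R ^^ Suc j" using yx by auto
      then have "(x, x) \<in> R ^^ (i + Suc j)" using ij(3) relpow_trans by metis
      then show False using odd[of "i + Suc j" x] ij(1,2) by simp
    qed
    moreover have "c x \<or> c y"
      using n Suc_n even_Suc[of n] by (auto simp only: c_def)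
    ultimately show ?thesis by blast
  qed
  then show ?thesis by blast
qed

context walled_graph
begin

text \<open>Each neighbour of \<open>b\<close> contributes the edge joining its two walls;
  neighbours with coinciding walls would give loops and are left out.\<close>

definition link :: "'a \<Rightarrow> ('a set \<times> 'a set) set" where
  "link b = {(A, B). A \<noteq> B \<and> (\<exists>v. edge b v \<and> walls b v = {A, B})}"

lemma sym_link: "sym (link b)"
  by (auto simp: sym_def link_def insert_commute)

lemma link_sym: "(A, B) \<in> link b \<Longrightarrow> (B, A) \<in> link b"
  using sym_link by (meson symE)

lemma linkI: "\<lbrakk>edge b v; A \<in> walls b v; B \<in> walls b v; A \<noteq> B\<rbrakk> \<Longrightarrow> (A, B) \<in> link b"
proof -
  assume *: "edge b v" "A \<in> walls b v" "B \<in> walls b v" "A \<noteq> B"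
  obtain A' B' where "walls b v = {A', B'}" using walls_pair[OF *(1)] by blast
  then have "walls b v = {A, B}" using * by auto
  then show ?thesis using * by (auto simp: link_def)
qed

end

text \<open>An odd closed walk that is shortest among the links of all vertices, not only of
  \<open>b\<close>, because the reduction passes to the link of a neighbour.\<close>

locale minimal_odd_cycle = walled_graph +
  fixes b n f
  assumes minimal: "\<And>m c A. \<lbrakk>m < n; odd m\<rbrakk> \<Longrightarrow> (A, A) \<notin> link c ^^ m"
    and odd: "odd n"
    and cycle: "\<And>i. i < n \<Longrightarrow> (f i, f (Suc i)) \<in> link b" "f n = f 0"
begin

lemma path: "\<lbrakk>i \<le> j; j \<le> n\<rbrakk> \<Longrightarrow> (f i, f j) \<in> link b ^^ (j - i)"
  using relpow_path cycle(1) .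

lemma return_path:
  assumes "i \<le> j" "j \<le> n"
  shows "(f j, f i) \<in> link b ^^ (n - (j - i))"
proof -
  have "(f j, f n) \<in> link b ^^ (n - j)" "(f n, f i) \<in> link b ^^ i"
    using path[of j n] path[of 0 i] assms cycle(2) by auto
  then have "(f j, f i) \<in> link b ^^ (n - j + i)" using relpow_trans by metis
  moreover have "n - j + i = n - (j - i)" using assms by auto
  ultimately show ?thesis by simp
qed

text \<open>A repetition splits the closed walk into two shorter ones whose lengths add up to
  \<open>n\<close>, and one of them is odd.\<close>

lemma inj:
  assumes "i < j" "j \<le> n" "j - i < n"
  shows "f i \<noteq> f j"
proof
  assume "f i = f j"
  then have "(f i, f i) \<in> link b ^^ (j - i)" "(f i, f i) \<in> link b ^^ (n - (j - i))"
    using path[of i j] return_path[of i j] assms by auto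
  moreover have "odd (j - i) \<or> odd (n - (j - i))" using odd assms by auto
  moreover have "j - i < n" "n - (j - i) < n" using assms by auto
  ultimately show False using minimal by blast
qed

text \<open>A chord would produce two shorter closed walks with lengths adding up to
  \<open>n + 2\<close>, and one of them would be odd.\<close>

lemma chordless:
  assumes "i + 2 \<le> j" "j \<le> n" "j - i \<le> n - 2"
  shows "(f i, f j) \<notin> link b"
proof
  assume chord: "(f i, f j) \<in> link b"
  have "(f i, f i) \<in> link b ^^ Suc (j - i)"
    using path[of i j] link_sym[OF chord] assms by auto
  moreover have "(f j, f j) \<in> link b ^^ Suc (n - (j - i))"
    using return_path[of i j] chord assms by auto
  moreover have "odd (Suc (j - i)) \<or> odd (Suc (n - (j - i)))" using odd assms by auto
  moreover have "Suc (j - i) < n" "Suc (n - (j - i)) < n" using assms by auto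
  ultimately show False using minimal by blast
qed

definition nbr :: "nat \<Rightarrow> 'a" where
  "nbr i = (SOME v. edge b v \<and> walls b v = {f i, f (Suc i)})"

lemma nbr:
  assumes "i < n"
  shows edge_nbr: "edge b (nbr i)" and walls_nbr: "walls b (nbr i) = {f i, f (Suc i)}"
proof -
  have "\<exists>v. edge b v \<and> walls b v = {f i, f (Suc i)}"
    using cycle(1)[OF assms] by (auto simp: link_def)
  from someI_ex[OF this] show "edge b (nbr i)" "walls b (nbr i) = {f i, f (Suc i)}"
    by (simp_all add: nbr_def)
qed

text \<open>The two cycle edges have no wall in common, so the neighbours are at distance 2. If
  \<open>b\<close> were the apex of a pyramid over a square through them, the vertices
  \<open>a\<close> and \<open>c\<close> would be link edges matching \<open>{f i, f (Suc i)}\<close>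
  with \<open>{f j, f (Suc j)}\<close>, contrary to the absence of chords.\<close>

lemma square_over:
  assumes ij: "i + 2 \<le> j" "j < n" "j - i \<le> n - 2"
  shows "\<exists>x. edge (nbr i) x \<and> edge x (nbr j) \<and> d b x = 2 \<and> d (nbr i) (nbr j) = 2"
proof -
  have i: "i < n" using ij by simp
  note vi = edge_nbr[OF i] walls_nbr[OF i] and vj = edge_nbr[OF ij(2)] walls_nbr[OF ij(2)]
  have "f i \<noteq> f j" "f i \<noteq> f (Suc j)" "f (Suc i) \<noteq> f j" "f (Suc i) \<noteq> f (Suc j)"
    by (rule inj; use ij in linarith)+
  then have disj: "A \<noteq> B" if "A \<in> walls b (nbr i)" "B \<in> walls b (nbr j)" for A B
    using that unfolding vi vj by auto
  have "nbr i \<noteq> nbr j" using disj[of "f i" "f i"] vi(2) by auto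
  moreover have "\<not> edge (nbr i) (nbr j)" using neighbours_share_wall[OF vi(1) vj(1)] disj by blast
  ultimately have d2: "d (nbr i) (nbr j) = 2" using dist_2I[OF edge_sym[OF vi(1)] vj(1)] by blast
  from square_or_pyramid[OF edge_sym[OF vi(1)] vj(1) d2] show ?thesis
  proof (elim disjE exE conjE)
    fix c assume "edge (nbr i) c" "edge c (nbr j)" "d b c = 2"
    then show ?thesis using d2 by blast
  next
    fix a c assume *: "edge (nbr i) a" "edge a (nbr j)" "edge (nbr i) c" "edge c (nbr j)"
      "d a c = 2" "edge b a" "edge b c"
    obtain A where A: "A \<in> walls b (nbr i)" "A \<in> walls b a"
      using neighbours_share_wall[OF vi(1) *(6,1)] by blast
    obtain B where B: "B \<in> walls b (nbr j)" "B \<in> walls b a"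
      using neighbours_share_wall[OF vj(1) *(6) edge_sym[OF *(2)]] by blast
    obtain A' where A': "A' \<in> walls b (nbr i)" "A' \<in> walls b c"
      using neighbours_share_wall[OF vi(1) *(7,3)] by blast
    obtain B' where B': "B' \<in> walls b (nbr j)" "B' \<in> walls b c"
      using neighbours_share_wall[OF vj(1) *(7) edge_sym[OF *(4)]] by blast
    have ne: "A \<noteq> A'" "B \<noteq> B'" using shared_wall_not_dist_2[OF *(6,7)] A A' B B' *(5) by blast+
    have l: "(A, B) \<in> link b" "(A', B') \<in> link b"
      using linkI[OF *(6) A(2) B(2) disj[OF A(1) B(1)]] linkI[OF *(7) A'(2) B'(2) disj[OF A'(1) B'(1)]] .
    have "((f i, f j) \<in> link b \<and> (f (Suc i), f (Suc j)) \<in> link b) \<or>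
          ((f i, f (Suc j)) \<in> link b \<and> (f (Suc i), f j) \<in> link b)"
      using A(1) B(1) A'(1) B'(1) ne l unfolding vi vj by auto
    moreover have "(f i, f j) \<notin> link b" using chordless[of i j] ij by auto
    moreover have "(f i, f (Suc j)) \<notin> link b \<or> (f (Suc i), f j) \<notin> link b"
    proof (cases "Suc j - i \<le> n - 2")
      case True
      then show ?thesis using chordless[of i "Suc j"] ij by auto
    next
      case False
      \<comment> \<open>Here \<open>j - i\<close> is \<open>n - 2\<close>, so \<open>f i\<close> and
        \<open>f (Suc j)\<close> may be consecutive on the cycle. Oddness then makes
        \<open>n\<close> at least 5, and the other pair is a genuine chord.\<close>
      have "n \<noteq> 4" using odd by auto
      then have "Suc i + 2 \<le> j" using False ij by linarith
      then show ?thesis using chordless[of "Suc i" j] ij by auto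
    qed
    ultimately show ?thesis by blast
  qed
qed

text \<open>Pivoting to the neighbour \<open>w\<close> of \<open>b\<close> across \<open>f 0\<close> and \<open>f 1\<close> turns the cycle
  \<open>f 0, \<dots>, f (n - 1)\<close> into the odd cycle \<open>f 2, \<dots>, f (n - 1)\<close> in the link of \<open>w\<close>.\<close>

lemma contradiction: False
proof -
  have "n \<noteq> 1" using cycle(1)[of 0] cycle(2) by (auto simp: link_def)
  then have n3: "n \<ge> 3" using odd by presburger
  define w where "w = nbr 0"
  have w: "edge b w" "walls b w = {f 0, f 1}" using nbr[of 0] n3 by (auto simp: w_def)
  define l where "l = nbr (n - 1)"
  have l: "edge b l" "walls b l = {f (n - 1), f 0}"
    using nbr[of "n - 1"] n3 cycle(2) by (auto simp: l_def)
  define v where "v = nbr 1"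
  have v: "edge b v" "walls b v = {f 1, f 2}"
    using nbr[of 1] n3 by (auto simp: v_def numeral_2_eq_2)
  have ne: "f 0 \<noteq> f 1" "f 1 \<noteq> f 2" "f 0 \<noteq> f 2" "f 0 \<noteq> f (n - 1)" "f 1 \<noteq> f (n - 1)"
    using inj[of 0 1] inj[of 1 2] inj[of 0 2] inj[of 0 "n - 1"] inj[of 1 "n - 1"] n3 by auto
  have "w \<noteq> v" "w \<noteq> l" using w(2) v(2) l(2) ne doubleton_eq_iff by metis+
  then have wv: "edge w v" and wl: "edge w l"
    using shared_wall_edge[OF w(1) v(1), of "f 1"] shared_wall_edge[OF w(1) l(1), of "f 0"]
    by (simp_all add: w(2) v(2) l(2))
  have walls: "f i \<in> all_walls" "b \<in> f i" if "i < n" for i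
    using all_wallsI[OF edge_nbr[OF that]] wall_sides(3)[OF edge_nbr[OF that]]
    by (simp_all add: walls_nbr[OF that])
  show False
  proof (cases "n = 3")
    case True
    then have l2: "walls b l = {f 2, f 0}" using l(2) by simp
    have "v \<noteq> l" using v(2) l2 ne doubleton_eq_iff by metis
    then have vl: "edge v l"
      using shared_wall_edge[OF v(1) l(1), of "f 2"] by (simp add: v(2) l2)
    \<comment> \<open>Since \<open>f 0\<close> is not a wall of \<open>bv\<close>, it keeps
      \<open>v\<close> on the side of \<open>b\<close>. But \<open>v\<close> and \<open>l\<close>
      are adjacent and both equidistant from \<open>b\<close> and \<open>w\<close>, so
      \<open>f 0\<close> cannot separate them.\<close>
    have "v \<in> f 0"
      using separating_wall[OF walls(1) v(1) walls(2), of 0] v(2) ne n3 by auto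
    moreover have "l \<notin> f 0" using wall_sides(4)[OF l(1)] l2 by auto
    ultimately show False
      using walls_component[OF w(1) _ vl, of "f 0"] w(2) edgeD[OF wv] edgeD[OF wl] edgeD[OF v(1)] edgeD[OF l(1)]
      by auto
  next
    case False
    then have n5: "n \<ge> 5" using n3 odd by presburger
    \<comment> \<open>The square on \<open>b\<close>, \<open>nbr j\<close>, \<open>x\<close>,
      \<open>w\<close> carries both walls of the edge from \<open>b\<close> to \<open>nbr j\<close>
      over to \<open>wx\<close>.\<close>
    have pivot: "(f j, f (Suc j)) \<in> link w" if j: "2 \<le> j" "j \<le> n - 2" for j
    proof -
      have "0 + 2 \<le> j" "j < n" "j - 0 \<le> n - 2" using j n5 by auto
      then obtain x where x: "edge w x" "edge x (nbr j)" "d b x = 2" "d w (nbr j) = 2"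
        using square_over[of 0 j] unfolding w_def by blast
      have bj: "edge b (nbr j)" "walls b (nbr j) = {f j, f (Suc j)}"
        using nbr[of j] \<open>j < n\<close> by auto
      have "d (nbr j) w = 2" using x(4) dist_commute edgeD(2)[OF w(1)] edgeD(2)[OF bj(1)] by simp
      then have "walls w x = {f j, f (Suc j)}"
        using square_walls[of b "nbr j" x w] bj x w(1) edge_sym by metis
      moreover have "f j \<noteq> f (Suc j)" using inj[of j "Suc j"] \<open>j < n\<close> n5 by auto
      ultimately show ?thesis using linkI[OF x(1)] by auto
    qed
    \<comment> \<open>The closing edge comes from the vertex \<open>y\<close> opposite
      \<open>b\<close> in a square with \<open>v\<close> and \<open>l\<close>. Positioning from
      \<open>w\<close>, which is adjacent to \<open>b\<close>, \<open>v\<close> and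
      \<open>l\<close>, makes \<open>w\<close> adjacent to \<open>y\<close>.\<close>
    have "1 + 2 \<le> n - 1" "n - 1 < n" "n - 1 - 1 \<le> n - 2" using n5 by auto
    then obtain y where y: "edge v y" "edge y l" "d b y = 2" "d v l = 2"
      using square_over[of 1 "n - 1"] unfolding v_def l_def by blast
    have lv: "d l v = 2" using y(4) dist_commute edgeD(2)[OF v(1)] edgeD(2)[OF l(1)] by simp
    have "d w b + d w y = d w v + d w l"
      using positioning[of b v y l w] v(1) l(1) y edge_sym edgeD(2)[OF w(1)] by blast
    then have wy: "edge w y"
      using edgeD[OF w(1)] edgeD[OF wv] edgeD[OF wl] edgeD[OF y(2)] by (auto simp: edge_def)
    \<comment> \<open>A wall of the cycle other than \<open>f 0\<close> and \<open>f 1\<close> still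
      contains \<open>w\<close>; if it misses \<open>y\<close>, it separates the edge
      \<open>wy\<close>.\<close>
    have side: "f i \<in> walls w y" if "i < n" "f i \<noteq> f 0" "f i \<noteq> f 1" "y \<notin> f i" for i
    proof -
      have "w \<in> f i"
        using separating_wall[OF walls(1) w(1) walls(2), of i] w(2) that by auto
      then show ?thesis using separating_wall[OF walls(1) wy] that by blast
    qed
    have "walls b v = walls l y"
      using square_walls[of b v y l] v(1) y l(1) edge_sym by blast
    then have "y \<notin> f 2" using wall_sides(4)[OF edge_sym[OF y(2)]] v(2) by blast
    then have 2: "f 2 \<in> walls w y" using side[of 2] n5 ne by auto
    have "walls b l = walls v y"
      using square_walls[of b l y v] v(1) y l(1) edge_sym lv by blast
    then have "y \<notin> f (n - 1)" using wall_sides(4)[OF y(1)] l(2) by blast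
    then have "f (n - 1) \<in> walls w y" using side[of "n - 1"] n5 ne by auto
    moreover have "f 2 \<noteq> f (n - 1)" using inj[of 2 "n - 1"] n5 by auto
    ultimately have closing: "(f (n - 1), f 2) \<in> link w" using linkI[OF wy] 2 by auto
    have "(f 2, f (n - 1)) \<in> link w ^^ (n - 3)"
      unfolding relpow_fun_conv
    proof (rule exI[of _ "\<lambda>k. f (k + 2)"], intro conjI allI impI)
      show "f (n - 3 + 2) = f (n - 1)" using n5 by (intro arg_cong[of _ _ f]) simp
      fix i assume "i < n - 3"
      then show "(f (i + 2), f (Suc i + 2)) \<in> link w" using pivot[of "i + 2"] by simp
    qed (simp add: numeral_2_eq_2)
    then have "(f 2, f 2) \<in> link w ^^ Suc (n - 3)" using closing by auto
    moreover have "Suc (n - 3) < n" "odd (Suc (n - 3))" using n5 odd by auto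
    ultimately show False using minimal by blast
  qed
qed

end

context walled_graph
begin

lemma link_no_odd_cycle: "odd n \<Longrightarrow> (A, A) \<notin> link b ^^ n"
proof (induction n arbitrary: A b rule: less_induct)
  case (less n)
  show ?case
  proof
    assume "(A, A) \<in> link b ^^ n"
    then obtain f where "f 0 = A" "f n = A" "\<forall>i<n. (f i, f (Suc i)) \<in> link b"
      by (auto simp: relpow_fun_conv)
    then interpret minimal_odd_cycle V d walls b n f
      using less by unfold_locales auto
    show False by (rule contradiction)
  qed
qed

end

subsection \<open>Orienting the walls\<close>

context walled_graph
begin

text \<open>A wall is double when both walls of an edge coincide; both of its sides are elements of the
  ground set then (they are parallel elements), whereas of every other wall exactly one side is.\<close>

definition double :: "'a set \<Rightarrow> bool" where
  "double H \<longleftrightarrow> (\<exists>u v. edge u v \<and> walls u v = {H})"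

lemma double_singleton:
  assumes "double H" "edge u v" "H \<in> walls u v"
  shows "walls u v = {H}"
proof -
  obtain p q where pq: "edge p q" "walls p q = {H}" using assms(1) by (auto simp: double_def)
  then show ?thesis
    using wall_of_separated_edge[of p q H u v] wall_sides(3,4)[OF assms(2,3)] assms(2) by simp
qed

lemma walls_compl_eq: "edge u v \<Longrightarrow> walls v u = (\<lambda>H. V - H) ` walls u v"
proof (intro equalityI subsetI)
  fix H assume uv: "edge u v" and H: "H \<in> walls v u"
  have "V - (V - H) = H" using wall_sides(5)[OF edge_sym[OF uv] H] by (simp add: double_diff)
  then show "H \<in> (\<lambda>H. V - H) ` walls u v" using walls_compl[OF edge_sym[OF uv] H] by (metis imageI)
qed (use walls_compl in blast)

lemma double_compl: "double H \<Longrightarrow> double (V - H)"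
  unfolding double_def using walls_compl_eq edge_sym by (metis image_empty image_insert)

end

locale oriented_walls = walled_graph +
  fixes \<Lambda> :: "'a set set"
  assumes \<Lambda>_walls: "\<Lambda> \<subseteq> all_walls"
    and double_in: "\<lbrakk>H \<in> all_walls; double H\<rbrakk> \<Longrightarrow> H \<in> \<Lambda>"
    and one_side: "\<lbrakk>H \<in> all_walls; \<not> double H\<rbrakk> \<Longrightarrow> H \<in> \<Lambda> \<longleftrightarrow> V - H \<notin> \<Lambda>"
begin

definition oriented :: "'a \<Rightarrow> 'a \<Rightarrow> bool" where
  "oriented u v \<longleftrightarrow> (\<exists>!H. H \<in> walls u v \<and> H \<in> \<Lambda>)"

lemma oriented_cong: "walls u v = walls u' v' \<Longrightarrow> oriented u v \<longleftrightarrow> oriented u' v'"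
  by (simp add: oriented_def)

lemma oriented_pair:
  assumes "walls u v = {A, B}" "A \<noteq> B"
  shows "oriented u v \<longleftrightarrow> (A \<in> \<Lambda>) \<noteq> (B \<in> \<Lambda>)"
  using assms by (auto simp: oriented_def)

lemma not_double:
  assumes "edge u v" "walls u v = {A, B}" "A \<noteq> B"
  shows "\<not> double A" "\<not> double B"
  using double_singleton[OF _ assms(1), of A] double_singleton[OF _ assms(1), of B] assms by auto

text \<open>Passing to complements exchanges chosen and unchosen sides, so exactly one of the two
  stays chosen. When the walls coincide, the complement is again double and therefore
  chosen.\<close>

lemma oriented_sym:
  assumes "edge u v" "oriented u v"
  shows "oriented v u"
proof -
  obtain A B where AB: "walls u v = {A, B}" using walls_pair[OF assms(1)] by blast
  have walls: "A \<in> all_walls" "B \<in> all_walls" using all_wallsI[OF assms(1)] AB by auto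
  have vu: "walls v u = {V - A, V - B}" using walls_compl_eq[OF assms(1)] AB by simp
  show ?thesis
  proof (cases "A = B")
    case True
    then have "double (V - A)" using edge_sym[OF assms(1)] vu unfolding double_def by auto
    then have "V - A \<in> \<Lambda>" using double_in all_walls_compl walls by blast
    then show ?thesis using vu True by (auto simp: oriented_def)
  next
    case False
    have "V - A \<noteq> V - B" using False all_walls_subset[OF walls(1)] all_walls_subset[OF walls(2)] by blast
    then show ?thesis
      using oriented_pair[OF vu] oriented_pair[OF AB False] assms(2)
        one_side[OF walls(1)] one_side[OF walls(2)] not_double[OF assms(1) AB False] by blast
  qed
qed

text \<open>The edges of a triangle use three walls, each shared by two edges:
  \<open>walls u v\<close> is \<open>{A, B}\<close>, \<open>walls v w\<close> is
  \<open>{D, V - A}\<close> and \<open>walls u w\<close> is \<open>{B, D}\<close>. Exactly one of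
  \<open>A\<close> and \<open>V - A\<close> is chosen, which settles \<open>B\<close> and
  \<open>D\<close>.\<close>

lemma oriented_triangle:
  assumes "edge u v" "edge v w" "edge u w" "oriented u v" "oriented v w"
  shows "oriented u w"
proof -
  obtain A B where AB: "walls u v = {A, B}" "w \<in> A" "w \<notin> B" using triangle_pair assms by metis
  obtain D D' where DD: "walls v w = {D, D'}" "u \<in> D" "u \<notin> D'"
    using triangle_pair[OF assms(2) edge_sym[OF assms(3)] edge_sym[OF assms(1)]] .
  have "A \<noteq> B" "D \<noteq> D'" using AB DD by auto
  have A: "A \<in> walls u v" and B: "B \<in> walls u v" using AB by auto
  have "A \<in> walls w v" using triangle_wall_in[OF assms(1-3) A] AB by blast
  then have "V - A \<in> walls v w" using walls_compl edge_sym[OF assms(2)] by blast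
  moreover have "u \<notin> V - A" using wall_sides(3)[OF assms(1) A] by blast
  ultimately have D': "D' = V - A" using DD by auto
  have BW: "B \<in> walls u w" using triangle_wall_notin[OF assms(1-3) B] AB by blast
  have DW: "D \<in> walls u w"
    using triangle_wall_in[OF assms(2) edge_sym[OF assms(3)] edge_sym[OF assms(1)], of D] DD by blast
  have "v \<in> D" "v \<notin> B" using wall_sides(3)[OF assms(2), of D] wall_sides(4)[OF assms(1) B] DD by auto
  then have "B \<noteq> D" by blast
  obtain X Y where "walls u w = {X, Y}" using walls_pair[OF assms(3)] by blast
  then have uw: "walls u w = {B, D}" using BW DW \<open>B \<noteq> D\<close> by auto
  have "A \<in> \<Lambda> \<longleftrightarrow> V - A \<notin> \<Lambda>"
    using one_side not_double(1)[OF assms(1) AB(1) \<open>A \<noteq> B\<close>] all_wallsI[OF assms(1) A] by blast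
  then show ?thesis
    using oriented_pair[OF AB(1) \<open>A \<noteq> B\<close>] oriented_pair[OF DD(1) \<open>D \<noteq> D'\<close>]
      oriented_pair[OF uw \<open>B \<noteq> D\<close>] assms(4,5) D' by blast
qed

text \<open>If \<open>x\<close> is at distance 2 from \<open>b\<close>, either \<open>mx\<close> is
  opposite an edge at \<open>b\<close> in a square, or \<open>m\<close> is an apex: then
  \<open>ax\<close> is opposite \<open>bc\<close>, and the triangle on \<open>m\<close>,
  \<open>a\<close>, \<open>x\<close> finishes.\<close>

lemma oriented_propagate:
  assumes "\<And>v. edge b v \<Longrightarrow> oriented b v" "edge b m" "edge m x"
  shows "oriented m x"
proof -
  have mb: "oriented m b" using oriented_sym assms by blast
  have via: "oriented m x" if "edge b x"
    using oriented_triangle[OF edge_sym[OF assms(2)] that assms(3) mb assms(1)[OF that]] .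
  consider "x = b" | "edge b x" | "d b x = 2" using dist_2I[OF assms(2,3)] by blast
  then show ?thesis
  proof cases
    case 3
    then have xb: "d x b = 2" using dist_commute edgeD(1)[OF assms(2)] edgeD(2)[OF assms(3)] by simp
    from square_or_pyramid[OF assms(2,3) 3] show ?thesis
    proof (elim disjE exE conjE)
      fix c assume c: "edge b c" "edge c x" "d m c = 2"
      then have "walls b c = walls m x"
        using square_walls[OF c(1,2) edge_sym[OF assms(3)] edge_sym[OF assms(2)] 3]
          dist_commute edgeD(1)[OF assms(3)] edgeD(2)[OF c(1)] by simp
      then show ?thesis using oriented_cong assms(1)[OF c(1)] by blast
    next
      fix a c assume *: "edge b a" "edge a x" "edge b c" "edge c x" "d a c = 2" "edge m a" "edge m c"
      have ma: "oriented m a"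
        using oriented_triangle[OF edge_sym[OF assms(2)] *(1,6) mb assms(1)[OF *(1)]] .
      have "walls b c = walls a x"
        using square_walls[OF *(3,4) edge_sym[OF *(2)] edge_sym[OF *(1)] 3]
          dist_commute edgeD(2)[OF *(1)] edgeD(2)[OF *(3)] *(5) by simp
      then have "oriented a x" using oriented_cong assms(1)[OF *(3)] by blast
      then show ?thesis using oriented_triangle[OF *(6,2) assms(3) ma] by blast
    qed
  qed (use mb via in auto)
qed

lemma oriented_all:
  assumes "b \<in> V" "\<And>v. edge b v \<Longrightarrow> oriented b v" "edge u v"
  shows "oriented u v"
  using assms
proof (induction "d b u" arbitrary: b v)
  case 0
  then show ?case using dist_0[of b u] edgeD(1)[of u v] by auto
next
  case (Suc k)
  obtain m where "edge b m" "m \<in> V" "d m u = k"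
    using edge_towards[of b u k] Suc edgeD by metis
  then show ?case using Suc(1)[of m v] oriented_propagate Suc.prems by blast
qed

end

lemma (in walled_graph) oriented_walls_exist:
  "\<exists>\<Lambda>. oriented_walls V d walls \<Lambda> \<and> (\<forall>u v. edge u v \<longrightarrow> oriented_walls.oriented walls \<Lambda> u v)"
proof (cases "V = {}")
  case True
  then have "\<not> edge u v" for u v using edgeD(1)[of u v] by blast
  then have "oriented_walls V d walls {}" by unfold_locales (auto simp: all_walls_def)
  then show ?thesis using \<open>\<And>u v. \<not> edge u v\<close> by blast
next
  case False
  then obtain b where b: "b \<in> V" by blast
  have "\<exists>c :: 'a set \<Rightarrow> bool. \<forall>(A, B)\<in>link b. c A \<noteq> c B"
    using two_colouring[OF sym_link] link_no_odd_cycle .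
  then obtain c :: "'a set \<Rightarrow> bool" where c: "\<And>A B. (A, B) \<in> link b \<Longrightarrow> c A \<noteq> c B" by blast
  \<comment> \<open>The colouring decides the sides containing \<open>b\<close>. Any other side is
    decided through its complement, which does contain \<open>b\<close>.\<close>
  define \<Lambda> where "\<Lambda> = {H \<in> all_walls. double H \<or> (if b \<in> H then c H else \<not> c (V - H))}"
  interpret oriented_walls V d walls \<Lambda>
  proof
    show "H \<in> \<Lambda> \<longleftrightarrow> V - H \<notin> \<Lambda>" if H: "H \<in> all_walls" "\<not> double H" for H
    proof -
      have "V - (V - H) = H" using all_walls_subset[OF H(1)] by (simp add: double_diff)
      moreover have "\<not> double (V - H)" using double_compl[of "V - H"] H calculation by auto
      ultimately show ?thesis using b H all_walls_compl[OF H(1)] by (auto simp: \<Lambda>_def)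
    qed
  qed (auto simp: \<Lambda>_def)
  have "oriented b v" if bv: "edge b v" for v
  proof -
    obtain A B where AB: "walls b v = {A, B}" using walls_pair[OF bv] by blast
    have A: "A \<in> all_walls" "b \<in> A" and B: "B \<in> all_walls" "b \<in> B"
      using all_wallsI[OF bv] wall_sides(3)[OF bv] AB by auto
    show ?thesis
    proof (cases "A = B")
      case True
      then have "double A" using AB bv by (auto simp: double_def)
      then show ?thesis using double_in A AB True by (auto simp: oriented_def)
    next
      case False
      then have "(A, B) \<in> link b" using linkI[OF bv] AB by auto
      then show ?thesis
        using c[of A B] not_double[OF bv AB False] A B oriented_pair[OF AB False] by (auto simp: \<Lambda>_def)
    qed
  qed
  then have "\<forall>u v. edge u v \<longrightarrow> oriented u v" using oriented_all b by blast
  then show ?thesis using oriented_walls_axioms by blast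
qed

section \<open>Vertices as bases, and the exchange property\<close>

locale coherent_walls = oriented_walls +
  assumes oriented: "edge u v \<Longrightarrow> oriented u v"
begin

definition basis :: "'a \<Rightarrow> 'a set set" where
  "basis v = {H \<in> \<Lambda>. v \<in> H}"

lemma basis_edge_diff:
  assumes "edge u v"
  shows "\<exists>H. H \<in> walls u v \<and> basis u - basis v = {H}"
proof -
  obtain H where H: "H \<in> walls u v" "H \<in> \<Lambda>" "\<And>K. \<lbrakk>K \<in> walls u v; K \<in> \<Lambda>\<rbrakk> \<Longrightarrow> K = H"
    using oriented[OF assms] by (auto simp: oriented_def)
  have "K = H" if "K \<in> basis u - basis v" for K
  proof -
    have K: "K \<in> \<Lambda>" "u \<in> K" "v \<notin> K" using that by (auto simp: basis_def)
    then show ?thesis using separating_wall[OF _ assms] \<Lambda>_walls H(3) by blast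
  qed
  moreover have "H \<in> basis u - basis v"
    using H(2) wall_sides(3,4)[OF assms H(1)] by (simp add: basis_def)
  ultimately show ?thesis using H(1) by blast
qed

lemma basis_between:
  assumes "u \<in> V" "v \<in> V" "w \<in> V" "d u w + d w v = d u v"
  shows "basis u \<inter> basis v \<subseteq> basis w" "basis w \<subseteq> basis u \<union> basis v"
proof -
  have "halfspace H" if "H \<in> \<Lambda>" for H using that \<Lambda>_walls all_walls_halfspace by blast
  then show "basis u \<inter> basis v \<subseteq> basis w" "basis w \<subseteq> basis u \<union> basis v"
    using halfspace_in halfspace_notin assms unfolding basis_def by blast+
qed

text \<open>Sides of walls are convex, so an exchange along a geodesic removes an element that
  \<open>v\<close> lacks and inserts one that \<open>v\<close> has.\<close>

lemma basis_step:
  assumes "u \<in> V" "v \<in> V" "edge u w" "d u v = Suc (d w v)"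
  obtains H K where "basis u - basis w = {H}" "basis w = insert K (basis u - {H})"
    "H \<in> basis u - basis v" "K \<in> basis v - basis u"
proof -
  obtain H where H: "basis u - basis w = {H}" using basis_edge_diff[OF assms(3)] by blast
  obtain K where K: "basis w - basis u = {K}"
    using basis_edge_diff[OF edge_sym[OF assms(3)]] by blast
  have "d u w + d w v = d u v" using assms(4) edgeD[OF assms(3)] by simp
  note between = basis_between[OF assms(1,2) edgeD(2)[OF assms(3)] this]
  have "H \<in> basis u - basis w" "K \<in> basis w - basis u" using H K by simp_all
  then have "H \<in> basis u - basis v" "K \<in> basis v - basis u" using between by blast+
  moreover have "basis w = (basis w - basis u) \<union> (basis u - (basis u - basis w))" by blast
  ultimately show thesis using that[of H K] H K by simp
qed

text \<open>Each step of a geodesic shortens both differences by one element; in particular all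
  differences are finite although the ground set may be infinite.\<close>

lemma basis_diff_card:
  assumes "u \<in> V" "v \<in> V"
  shows "finite (basis u - basis v) \<and> card (basis u - basis v) = d u v
    \<and> finite (basis v - basis u) \<and> card (basis v - basis u) = d u v"
  using assms(1)
proof (induction "d u v" arbitrary: u)
  case 0
  then have "u = v" using dist_0[of u v] assms(2) by simp
  then show ?case using 0 by simp
next
  case (Suc k)
  obtain w where w: "edge u w" "w \<in> V" "d w v = k" using edge_towards[of u v k] Suc assms by metis
  have "d u v = Suc (d w v)" using w Suc by simp
  from basis_step[OF Suc.prems assms(2) w(1) this] obtain H K where
    step: "basis u - basis w = {H}" "basis w = insert K (basis u - {H})"
      "H \<in> basis u - basis v" "K \<in> basis v - basis u" .
  have "basis u - basis v = insert H (basis w - basis v)" "H \<notin> basis w - basis v"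
      "basis v - basis u = insert K (basis v - basis w)" "K \<notin> basis v - basis w"
    using step(3,4) unfolding step(2) by auto
  then show ?case using Suc(1)[of w] w Suc(2) by simp
qed

lemma basis_inj: "inj_on basis V"
proof (rule inj_onI)
  fix u v assume "u \<in> V" "v \<in> V" "basis u = basis v"
  then show "u = v" using basis_diff_card[of u v] dist_0[of u v] by simp
qed

lemma basis_adjacent:
  assumes "u \<in> V" "v \<in> V"
  shows "card ((basis u - basis v) \<union> (basis v - basis u)) = 2 \<longleftrightarrow> d u v = 1"
proof -
  have "card ((basis u - basis v) \<union> (basis v - basis u)) = 2 * d u v"
    using basis_diff_card[OF assms] by (subst card_Un_disjoint) auto
  then show ?thesis by auto
qed

text \<open>The first step of a suitable geodesic leaves \<open>H\<close>; as a step loses only one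
  element, that element is \<open>H\<close>.\<close>

lemma basis_exchange:
  assumes "u \<in> V" "v \<in> V" "H \<in> basis u - basis v"
  shows "\<exists>K\<in>basis v - basis u. \<exists>w\<in>V. basis w = (basis u - {H}) \<union> {K}"
proof -
  have H: "halfspace H" "u \<in> H" "v \<notin> H" "H \<in> \<Lambda>"
    using assms(3) \<Lambda>_walls all_walls_halfspace by (auto simp: basis_def)
  obtain w where w: "edge u w" "w \<notin> H" "d u v = Suc (d w v)"
    using geodesic_crossing[OF H(1) assms(1,2) H(2,3)] by blast
  obtain H' K where step: "basis u - basis w = {H'}" "basis w = insert K (basis u - {H'})"
      "H' \<in> basis u - basis v" "K \<in> basis v - basis u"
    using basis_step[OF assms(1,2) w(1,3)] .
  have "H \<in> basis u - basis w" using H w by (auto simp: basis_def)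
  then have "basis w = (basis u - {H}) \<union> {K}" using step(1,2) by simp
  then show ?thesis using step(4) edgeD(2)[OF w(1)] by blast
qed

end

subsection \<open>Distances and components in graphs\<close>

lemma adj_commute: "adj G u v \<longleftrightarrow> adj G v u"
  by (simp add: adj_def insert_commute)

lemma simple_graph_adj:
  assumes "simple_graph G" "adj G u v"
  shows "u \<in> verts G" "v \<in> verts G" "u \<noteq> v"
proof -
  have "{u, v} \<subseteq> verts G" "card {u, v} = 2" using assms by (auto simp: simple_graph_def adj_def)
  then show "u \<in> verts G" "v \<in> verts G" "u \<noteq> v" by auto
qed

lemma gpath_rev: "gpath G u p v \<Longrightarrow> gpath G v (rev p) u"
  by (auto simp: gpath_def hd_rev last_rev successively_rev adj_commute[of G])

lemma gpath_singleton: "u \<in> verts G \<Longrightarrow> gpath G u [u] u"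
  by (simp add: gpath_def)

text \<open>Paths have distinct vertices, so walks obtained by concatenation are shortened by
  cutting out the part between two occurrences of a vertex.\<close>

lemma walk_imp_gpath:
  assumes "p \<noteq> []" "set p \<subseteq> verts G" "successively (adj G) p"
  shows "\<exists>q. gpath G (hd p) q (last p) \<and> length q \<le> length p"
  using assms
proof (induction "length p" arbitrary: p rule: less_induct)
  case less
  show ?case
  proof (cases "distinct p")
    case True
    then show ?thesis using less.prems by (auto simp: gpath_def)
  next
    case False
    then obtain xs ys zs y where p: "p = xs @ [y] @ ys @ [y] @ zs"
      using not_distinct_decomp by blast
    define q where "q = xs @ [y] @ zs"
    have "length q < length p" "q \<noteq> []" "set q \<subseteq> verts G" "hd q = hd p" "last q = last p"
      using less.prems(2) by (auto simp: p q_def hd_append)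
    moreover have "successively (adj G) q"
      using less.prems(3) by (auto simp: p q_def successively_append_iff successively_Cons)
    ultimately show ?thesis using less.hyps[of q] by fastforce
  qed
qed

lemma gpath_append:
  assumes "gpath G u p v" "gpath G v q w"
  shows "\<exists>r. gpath G u r w \<and> length r - 1 \<le> (length p - 1) + (length q - 1)"
proof -
  have p: "p \<noteq> []" "hd p = u" "last p = v" "set p \<subseteq> verts G" "successively (adj G) p"
    and q: "q \<noteq> []" "hd q = v" "last q = w" "set q \<subseteq> verts G" "successively (adj G) q"
    using assms by (auto simp: gpath_def)
  obtain q' where q': "q = v # q'" using q by (cases q) auto
  have "successively (adj G) (p @ q')"
    using p q unfolding q' by (cases q') (auto simp: successively_append_iff)
  moreover have "set (p @ q') \<subseteq> verts G" "hd (p @ q') = u" "last (p @ q') = w"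
    using p q unfolding q' by auto
  ultimately obtain r where "gpath G u r w" "length r \<le> length (p @ q')"
    using walk_imp_gpath[of "p @ q'" G] p by auto
  then show ?thesis using p(1) by (intro exI[of _ r]) (auto simp: q' Suc_leI)
qed

lemma gpath_edge: "\<lbrakk>simple_graph G; adj G u v\<rbrakk> \<Longrightarrow> gpath G u [u, v] v"
  using simple_graph_adj[of G u v] by (simp add: gpath_def)

lemma gpath_iff_rtranclp:
  assumes "simple_graph G" "u \<in> verts G"
  shows "(\<exists>p. gpath G u p v) \<longleftrightarrow> (adj G)\<^sup>*\<^sup>* u v"
proof
  assume "(adj G)\<^sup>*\<^sup>* u v"
  then show "\<exists>p. gpath G u p v"
  proof induction
    case base
    then show ?case using gpath_singleton[OF assms(2)] by (rule exI)
  next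
    case (step v w)
    then show ?case using gpath_append gpath_edge[OF assms(1)] by metis
  qed
next
  have "(adj G)\<^sup>*\<^sup>* (hd p) (last p)" if "p \<noteq> []" "successively (adj G) p" for p
    using that by (induction p rule: induct_list012) (auto intro: converse_rtranclp_into_rtranclp)
  then show "\<exists>p. gpath G u p v \<Longrightarrow> (adj G)\<^sup>*\<^sup>* u v" by (auto simp: gpath_def)
qed

lemma gdist_le: "gpath G u p v \<Longrightarrow> gdist G u v \<le> length p - 1"
  unfolding gdist_def by (rule Least_le) blast

lemma gdist_gpath:
  assumes "connected_graph G" "u \<in> verts G" "v \<in> verts G"
  obtains p where "gpath G u p v" "gdist G u v = length p - 1"
proof -
  have "\<exists>n p. gpath G u p v \<and> n = length p - 1" using assms by (auto simp: connected_graph_def)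
  from LeastI_ex[OF this] show thesis using that unfolding gdist_def by blast
qed

lemma gdist_0:
  assumes "connected_graph G" "u \<in> verts G" "v \<in> verts G"
  shows "gdist G u v = 0 \<longleftrightarrow> u = v"
proof
  assume "gdist G u v = 0"
  then obtain p where "gpath G u p v" "length p - 1 = 0" using gdist_gpath assms by metis
  then show "u = v" by (cases p) (auto simp: gpath_def)
next
  assume "u = v"
  then show "gdist G u v = 0" using gdist_le[OF gpath_singleton[OF assms(2)]] by simp
qed

lemma gdist_triangle:
  assumes "connected_graph G" "u \<in> verts G" "v \<in> verts G" "w \<in> verts G"
  shows "gdist G u w \<le> gdist G u v + gdist G v w"
proof -
  obtain p q where "gpath G u p v" "gdist G u v = length p - 1"
    "gpath G v q w" "gdist G v w = length q - 1" using gdist_gpath assms by metis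
  then show ?thesis using gpath_append[of G u p v q w] gdist_le[of G u _ w] by fastforce
qed

lemma gdist_1:
  assumes "simple_graph G" "connected_graph G" "u \<in> verts G" "v \<in> verts G"
  shows "gdist G u v = 1 \<longleftrightarrow> adj G u v"
proof
  assume "gdist G u v = 1"
  then obtain p where p: "gpath G u p v" "length p - 1 = 1" using gdist_gpath assms by metis
  then obtain x y where "p = [x, y]" by (cases p; cases "tl p") auto
  then show "adj G u v" using p by (auto simp: gpath_def)
next
  assume uv: "adj G u v"
  have "gdist G u v \<le> 1" "u \<noteq> v"
    using gdist_le[OF gpath_edge[OF assms(1) uv]] simple_graph_adj(3)[OF assms(1) uv] by simp_all
  then show "gdist G u v = 1" using gdist_0[OF assms(2-4)] by auto
qed

lemma gdist_step:
  assumes G: "simple_graph G" "connected_graph G" and V: "u \<in> verts G" "v \<in> verts G"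
    and n: "gdist G u v = Suc n"
  shows "\<exists>w\<in>verts G. gdist G u w = 1 \<and> gdist G w v = n"
proof -
  obtain p where p: "gpath G u p v" "length p - 1 = Suc n" using gdist_gpath assms by metis
  then obtain w q where q: "p = u # w # q" by (cases p; cases "tl p") (auto simp: gpath_def)
  then have w: "w \<in> verts G" "adj G u w" "gpath G w (w # q) v" using p by (auto simp: gpath_def)
  have "gdist G u w = 1" using gdist_1[OF G V(1) w(1)] w by simp
  moreover have "gdist G w v \<le> n" using gdist_le[OF w(3)] p q by simp
  ultimately show ?thesis using gdist_triangle[OF G(2) V(1) w(1) V(2)] n w(1) by force
qed

lemma gdist_commute: "gdist G u v = gdist G v u"
proof -
  have "(\<exists>p. gpath G u p v \<and> n = length p - 1) \<longleftrightarrow> (\<exists>p. gpath G v p u \<and> n = length p - 1)" for n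
    by (metis gpath_rev length_rev)
  then show ?thesis by (simp add: gdist_def)
qed

lemma gdist_graph_metric:
  assumes "simple_graph G" "connected_graph G"
  shows "graph_metric (verts G) (gdist G)"
proof
  show "gdist G x y = gdist G y x" for x y by (rule gdist_commute)
qed (fact gdist_0[OF assms(2)] gdist_triangle[OF assms(2)] gdist_step[OF assms])+

section \<open>Induced subgraphs and their components\<close>

lemma adj_induced: "adj (induced_subgraph G S) u v \<longleftrightarrow> adj G u v \<and> u \<in> S \<and> v \<in> S"
  by (auto simp: adj_def induced_subgraph_def)

lemma verts_induced: "verts (induced_subgraph G S) = verts G \<inter> S"
  by (simp add: induced_subgraph_def)

lemma simple_induced: "simple_graph G \<Longrightarrow> simple_graph (induced_subgraph G S)"
  by (auto simp: simple_graph_def induced_subgraph_def)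

lemma Union_component_sets: "\<Union> (component_sets H) = verts H"
  using gpath_singleton by (force simp: component_sets_def gpath_def)

lemma component_sets_closed:
  assumes "simple_graph H" "C \<in> component_sets H" "x \<in> C" "adj H x y"
  shows "y \<in> C"
proof -
  obtain u where u: "u \<in> verts H" "C = {v. \<exists>p. gpath H u p v}"
    using assms(2) by (auto simp: component_sets_def)
  then show ?thesis using assms(3,4) by (simp add: gpath_iff_rtranclp[OF assms(1)])
qed

lemma two_components_Un:
  assumes "two_components G S C D" "S \<subseteq> verts G"
  shows "C \<union> D = S"
proof -
  have "\<Union> ({C, D} - {{}}) = verts G \<inter> S"
    using assms(1) Union_component_sets[of "induced_subgraph G S"]
    by (simp add: two_components_def verts_induced)
  then show ?thesis using assms(2) by auto
qed

lemma two_components_commute: "two_components G S C D \<longleftrightarrow> two_components G S D C"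
  by (simp add: two_components_def insert_commute Int_commute)

lemma two_components_adj:
  assumes "simple_graph G" "S \<subseteq> verts G" "two_components G S C D" "x \<in> C" "y \<in> S" "adj G x y"
  shows "y \<in> C"
proof (rule component_sets_closed[OF simple_induced[OF assms(1)], of C S x])
  show "C \<in> component_sets (induced_subgraph G S)" using assms(3,4) by (auto simp: two_components_def)
  show "adj (induced_subgraph G S) x y"
    using assms two_components_Un[OF assms(3,2)] by (auto simp: adj_induced)
qed fact

text \<open>The padded pair of components is determined up to order, so the set of its members is
  independent of the pair supplied by (WC).\<close>

lemma two_components_unique:
  assumes "two_components G S C D"
  shows "{X. \<exists>Y. two_components G S X Y} = {C, D}"
proof (intro equalityI subsetI)
  fix X assume "X \<in> {X. \<exists>Y. two_components G S X Y}"
  then obtain Y where XY: "{X, Y} - {{}} = {C, D} - {{}}" and disj: "C \<inter> D = {}"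
    using assms by (auto simp: two_components_def)
  show "X \<in> {C, D}"
  proof (cases "X = {}")
    \<comment> \<open>If \<open>X\<close> is empty there is at most one nonempty component, and two
      disjoint sets cannot both be equal to it.\<close>
    case True
    then have "{C, D} - {{}} \<subseteq> {Y}" using XY[symmetric] by simp
    then have "C = {} \<or> D = {}" using disj by blast
    then show ?thesis using True by auto
  next
    case False
    then have "X \<in> {X, Y} - {{}}" by simp
    then show ?thesis unfolding XY by simp
  qed
qed (use assms two_components_commute in blast)

subsection \<open>Small graphs and the two conditions\<close>

lemma adj_square: "adj square_graph i j \<longleftrightarrow>
    (i, j) \<in> {(0, 1), (1, 0), (1, 2), (2, 1), (2, 3), (3, 2), (3, 0), (0, 3)}"
  by (auto simp: adj_def square_graph_def doubleton_eq_iff)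

lemma adj_pyramid: "adj pyramid_graph i j \<longleftrightarrow>
    (i, j) \<in> {(0, 1), (1, 0), (1, 2), (2, 1), (2, 3), (3, 2), (3, 0), (0, 3),
      (4, 0), (0, 4), (4, 1), (1, 4), (4, 2), (2, 4), (4, 3), (3, 4)}"
  by (auto simp: adj_def pyramid_graph_def doubleton_eq_iff)

lemma adj_octahedron: "adj octahedron_graph i j \<longleftrightarrow> i < 6 \<and> j < 6 \<and> i \<noteq> j \<and>
    (i, j) \<notin> {(0, 1), (1, 0), (2, 3), (3, 2), (4, 5), (5, 4)}"
  by (auto simp: adj_def octahedron_graph_def doubleton_eq_iff card_insert_if)

lemma verts_small_upt:
  "verts square_graph = {0..<4}" "verts pyramid_graph = {0..<5}" "verts octahedron_graph = {0..<6}"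
  by (simp_all add: square_graph_def pyramid_graph_def octahedron_graph_def)

lemma verts_small:
  "verts square_graph = {0, 1, 2, 3}" "verts pyramid_graph = {0, 1, 2, 3, 4}"
  "verts octahedron_graph = {0, 1, 2, 3, 4, 5}"
  by (auto simp: verts_small_upt)

text \<open>The only property of the three interval graphs that the construction of the matroid needs:
  a common neighbour \<open>m\<close> of two vertices lies in an induced square with them, or is the apex of a
  pyramid over such a square.\<close>

definition square_through :: "'a ugraph \<Rightarrow> 'a \<Rightarrow> 'a \<Rightarrow> 'a \<Rightarrow> bool" where
  "square_through K p m q \<longleftrightarrow>
     (\<exists>c\<in>verts K. adj K p c \<and> adj K c q \<and> c \<noteq> m \<and> \<not> adj K m c) \<or>
     (\<exists>a\<in>verts K. \<exists>c\<in>verts K. adj K p a \<and> adj K a q \<and> adj K p c \<and> adj K c q \<and>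
       a \<noteq> c \<and> \<not> adj K a c \<and> adj K m a \<and> adj K m c)"

definition interval_graph :: "'a ugraph \<Rightarrow> bool" where
  "interval_graph K \<longleftrightarrow> (\<forall>p\<in>verts K. \<forall>m\<in>verts K. \<forall>q\<in>verts K.
     p \<noteq> q \<and> \<not> adj K p q \<and> adj K p m \<and> adj K m q \<longrightarrow> square_through K p m q)"

lemma interval_graph_square: "interval_graph square_graph"
  unfolding interval_graph_def square_through_def verts_small adj_square by simp

lemma interval_graph_pyramid: "interval_graph pyramid_graph"
  unfolding interval_graph_def square_through_def verts_small adj_pyramid by simp

lemma interval_graph_octahedron: "interval_graph octahedron_graph"
  unfolding interval_graph_def square_through_def verts_small adj_octahedron by simp

lemma interval_graph_iso:
  assumes "graph_iso H K" "interval_graph K"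
  shows "interval_graph H"
proof -
  obtain f where f: "bij_betw f (verts H) (verts K)"
    and adj: "\<And>x y. \<lbrakk>x \<in> verts H; y \<in> verts H\<rbrakk> \<Longrightarrow> adj H x y \<longleftrightarrow> adj K (f x) (f y)"
    using assms(1) by (auto simp: graph_iso_def)
  have K: "verts K = f ` verts H" and inj: "inj_on f (verts H)" using f by (auto simp: bij_betw_def)
  have "square_through H p m q"
    if V: "p \<in> verts H" "m \<in> verts H" "q \<in> verts H"
      and "p \<noteq> q" "\<not> adj H p q" "adj H p m" "adj H m q" for p m q
  proof -
    have "square_through K (f p) (f m) (f q)"
      using assms(2) that inj_on_eq_iff[OF inj, of p q] adj K unfolding interval_graph_def by simp
    then show ?thesis
      using V inj_on_eq_iff[OF inj] adj unfolding square_through_def K by simp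
  qed
  then show ?thesis unfolding interval_graph_def by blast
qed

lemma graph_iso_of_list:
  assumes "distinct xs" "set xs = verts H" "verts K = {0..<length xs}"
    and "\<And>i j. \<lbrakk>i < length xs; j < length xs\<rbrakk> \<Longrightarrow> adj H (xs ! i) (xs ! j) \<longleftrightarrow> adj K i j"
  shows "graph_iso H K"
proof -
  have bij: "bij_betw ((!) xs) {0..<length xs} (verts H)"
    using assms(1,2) by (intro bij_betw_nth) auto
  define f where "f = inv_into {0..<length xs} ((!) xs)"
  have f: "f x < length xs" "xs ! f x = x" if "x \<in> verts H" for x
    using that bij_betw_inv_into_right[OF bij that] bij_betwE[OF bij_betw_inv_into[OF bij]]
    by (auto simp: f_def)
  have "bij_betw f (verts H) (verts K)"
    unfolding f_def assms(3) by (rule bij_betw_inv_into[OF bij])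
  moreover have "adj H x y \<longleftrightarrow> adj K (f x) (f y)" if "x \<in> verts H" "y \<in> verts H" for x y
    using assms(4)[of "f x" "f y"] f that by simp
  ultimately show ?thesis unfolding graph_iso_def by blast
qed

lemma W_eq_commute: "W_eq G u v = W_eq G v u"
  by (auto simp: W_eq_def)

text \<open>The empty padding counts as a component. For a connected nonempty
  \<open>W_eq G u v\<close> the two members are \<open>W_less G u v\<close> with and without it; for
  an empty one they coincide.\<close>

definition edge_walls :: "'a ugraph \<Rightarrow> 'a \<Rightarrow> 'a \<Rightarrow> 'a set set" where
  "edge_walls G u v = (\<lambda>C. W_less G u v \<union> C) ` {C. \<exists>D. two_components G (W_eq G u v) C D}"

lemma walled_graph_of_conditions:
  assumes G: "simple_graph G" "connected_graph G" and WC: "wall_condition G"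
    and IC: "interval_condition G"
  shows "walled_graph (verts G) (gdist G) (edge_walls G)"
proof -
  interpret graph_metric "verts G" "gdist G" using gdist_graph_metric[OF G] .
  have edge_iff: "edge u v \<longleftrightarrow> adj G u v" for u v
    using gdist_1[OF G] simple_graph_adj[OF G(1)] by (auto simp: edge_def)
  have convex_iff: "gconvex G A \<longleftrightarrow> convex A" for A
    unfolding gconvex_def convex_def ginterval_def by blast
  have closer: "W_less G = closer" by (auto simp: W_less_def closer_def fun_eq_iff)
  have W_eq: "W_eq G u v = verts G - closer u v - closer v u" for u v
    by (auto simp: W_eq_def closer_def)
  have comps: "\<exists>C D. two_components G (W_eq G u v) C D \<and> C \<inter> D = {} \<and> C \<union> D = W_eq G u v \<and>
      edge_walls G u v = {closer u v \<union> C, closer u v \<union> D} \<and>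
      edge_walls G v u = {closer v u \<union> C, closer v u \<union> D} \<and>
      halfspace (closer u v \<union> C) \<and> halfspace (closer u v \<union> D)" if uv: "edge u v" for u v
  proof -
    have "u \<in> verts G" "v \<in> verts G" "adj G u v" using uv edgeD edge_iff by auto
    then obtain C D where CD: "two_components G (W_eq G u v) C D"
      "complementary_halfspaces G (W_less G u v \<union> C) (W_less G v u \<union> D)"
      "complementary_halfspaces G (W_less G u v \<union> D) (W_less G v u \<union> C)"
      using WC unfolding wall_condition_def by blast
    have half: "halfspace A" if "complementary_halfspaces G A B" for A B
    proof -
      have "B = verts G - A" using that by (auto simp: complementary_halfspaces_def)
      then show ?thesis
        using that by (simp add: complementary_halfspaces_def halfspace_def convex_iff)
    qed
    have "C \<union> D = W_eq G u v" using two_components_Un[OF CD(1)] by (auto simp: W_eq_def)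
    moreover have "C \<inter> D = {}" using CD(1) by (simp add: two_components_def)
    moreover have "edge_walls G u v = {closer u v \<union> C, closer u v \<union> D}"
      "edge_walls G v u = {closer v u \<union> C, closer v u \<union> D}"
      using two_components_unique[OF CD(1)] W_eq_commute[of G v u] by (auto simp: edge_walls_def closer)
    moreover have "halfspace (closer u v \<union> C)" "halfspace (closer u v \<union> D)"
      using half[OF CD(2)] half[OF CD(3)] by (simp_all add: closer)
    ultimately show ?thesis using CD(1) by (intro exI[of _ C] exI[of _ D]) simp
  qed
  have disjoint: "closer u v \<inter> closer v u = {}" "closer u v \<subseteq> verts G" for u v
    by (auto simp: closer_def)
  show ?thesis
  proof
    fix u v assume uv: "edge u v"
    obtain C D where CD: "C \<inter> D = {}" "C \<union> D = W_eq G u v"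
      "edge_walls G u v = {closer u v \<union> C, closer u v \<union> D}"
      using comps[OF uv] by (elim exE conjE) (rule that; assumption)
    have "(closer u v \<union> C) \<union> (closer u v \<union> D) = closer u v \<union> (C \<union> D)" by blast
    also have "\<dots> = verts G - closer v u"
      unfolding CD(2) W_eq using disjoint[of u v] by blast
    finally have "(closer u v \<union> C) \<union> (closer u v \<union> D) = verts G - closer v u" .
    moreover have "(closer u v \<union> C) \<inter> (closer u v \<union> D) = closer u v" using CD(1) by blast
    ultimately show "\<exists>A B. edge_walls G u v = {A, B} \<and> A \<inter> B = closer u v \<and>
        A \<union> B = verts G - closer v u" using CD(3) by blast
  next
    fix u v H assume "edge u v" "H \<in> edge_walls G u v"
    then show "halfspace H" using comps[of u v] by fastforce
  next
    fix u v H x y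
    assume uv: "edge u v" and H: "H \<in> edge_walls G u v" and xy: "edge x y"
      and eq: "gdist G x u = gdist G x v" "gdist G y u = gdist G y v" and x: "x \<in> H"
    obtain C D where CD: "two_components G (W_eq G u v) C D" "H = closer u v \<union> C"
      using H by (auto simp: edge_walls_def closer)
    have "x \<in> C" using x eq CD(2) by (auto simp: closer_def)
    moreover have "y \<in> W_eq G u v" using eq edgeD(2)[OF xy] by (simp add: W_eq_def)
    ultimately show "y \<in> H"
      using two_components_adj[OF G(1) _ CD(1)] xy CD(2) by (auto simp: edge_iff W_eq_def)
  next
    fix u v H assume uv: "edge u v" and H: "H \<in> edge_walls G u v"
    obtain C D where CD: "C \<inter> D = {}" "C \<union> D = W_eq G u v"
      "edge_walls G u v = {closer u v \<union> C, closer u v \<union> D}"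
      "edge_walls G v u = {closer v u \<union> C, closer v u \<union> D}"
      using comps[OF uv] by (elim exE conjE) (rule that; assumption)
    have "x \<in> C \<or> x \<in> D \<longleftrightarrow> x \<in> verts G \<and> x \<notin> closer u v \<and> x \<notin> closer v u" for x
      using CD(2) unfolding W_eq by (simp add: set_eq_iff)
    then have "verts G - (closer u v \<union> C) = closer v u \<union> D" "verts G - (closer u v \<union> D) = closer v u \<union> C"
      using CD(1) disjoint[of u v] disjoint(2)[of v u] by blast+
    then show "verts G - H \<in> edge_walls G v u" using H CD(3,4) by auto
  next
    fix u v u' v'
    assume "closer u v = closer u' v'" "closer v u = closer v' u'"
    then show "edge_walls G u v = edge_walls G u' v'" by (simp add: edge_walls_def closer W_eq)
  next
    fix u m v assume um: "edge u m" and mv: "edge m v" and uv: "gdist G u v = 2"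
    define I where "I = ginterval G u v"
    define H where "H = induced_subgraph G I"
    have V: "u \<in> verts G" "v \<in> verts G" "m \<in> verts G" using um mv edgeD by auto
    have uvI: "u \<in> I" "v \<in> I" "m \<in> I"
      using V uv edgeD[OF um] edgeD[OF mv] gdist_0[OF G(2)] by (auto simp: I_def ginterval_def)
    have IV: "I \<subseteq> verts G" by (auto simp: I_def ginterval_def)
    \<comment> \<open>The property is checked on the three model graphs and transported along the
      isomorphism given by (IC).\<close>
    have "interval_graph H"
      using IC V uv interval_graph_iso interval_graph_square interval_graph_pyramid
        interval_graph_octahedron
      unfolding interval_condition_def H_def I_def Let_def by blast
    moreover have vH: "verts H = I" using IV by (auto simp: H_def verts_induced)
    moreover have aH: "adj H x y \<longleftrightarrow> edge x y" if "x \<in> I" "y \<in> I" for x y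
      using that by (simp add: H_def adj_induced edge_iff)
    moreover have "\<not> edge u v" "u \<noteq> v" using uv dist_0[OF V(1,2)] by (auto simp: edge_def)
    ultimately have "square_through H u m v"
      using um mv uvI unfolding interval_graph_def by blast
    then consider c where "edge u c" "edge c v" "c \<noteq> m" "\<not> edge m c"
      | a c where "edge u a" "edge a v" "edge u c" "edge c v" "a \<noteq> c" "\<not> edge a c" "edge m a" "edge m c"
      unfolding square_through_def vH using uvI aH by metis
    then show "(\<exists>c. edge u c \<and> edge c v \<and> gdist G m c = 2) \<or>
      (\<exists>a c. edge u a \<and> edge a v \<and> edge u c \<and> edge c v \<and> gdist G a c = 2 \<and> edge m a \<and> edge m c)"
    proof cases
      case 1
      then show ?thesis using dist_2I[OF edge_sym[OF um], of c] by blast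
    next
      case 2
      then show ?thesis using dist_2I[OF edge_sym[OF 2(1)], of c] by blast
    qed
  qed
qed

subsection \<open>Graphs labelled by the bases of a matroid\<close>

text \<open>The labels \<open>f x\<close> play the role of bases of a possibly infinite ground set;
  \<open>finite_diff\<close> obtains finiteness of their differences from geodesics.\<close>

locale exchange_graph = graph_metric V d for V :: "'a set" and d +
  fixes f :: "'a \<Rightarrow> 'b set"
  assumes inj: "inj_on f V"
    and exchange: "\<lbrakk>x \<in> V; y \<in> V; i \<in> f x - f y\<rbrakk> \<Longrightarrow>
      \<exists>j\<in>f y - f x. \<exists>z\<in>V. f z = insert j (f x - {i})"
    and dist_1_iff: "\<lbrakk>x \<in> V; y \<in> V\<rbrakk> \<Longrightarrow>
      d x y = 1 \<longleftrightarrow> card ((f x - f y) \<union> (f y - f x)) = 2"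
begin

lemma finite_diff:
  assumes "x \<in> V" "y \<in> V"
  shows "finite (f x - f y) \<and> finite (f y - f x)"
  using assms(1)
proof (induction "d x y" arbitrary: x)
  case 0
  then show ?case using dist_0[of x y] assms by auto
next
  case (Suc n)
  obtain z where z: "edge x z" "z \<in> V" "d z y = n" using edge_towards[of x y n] Suc assms by metis
  then have "card ((f x - f z) \<union> (f z - f x)) = 2" using dist_1_iff[of x z] edgeD Suc by auto
  \<comment> \<open>An infinite set has cardinality 0, so cardinality 2 forces finiteness.\<close>
  then have "finite ((f x - f z) \<union> (f z - f x))" by (metis card.infinite zero_neq_numeral)
  then have "finite (f x - f z)" "finite (f z - f x)" by auto
  moreover have "finite (f z - f y)" "finite (f y - f z)" using Suc(1)[of z] z by auto
  ultimately show ?case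
    using finite_subset[of "f x - f y" "(f x - f z) \<union> (f z - f y)"]
      finite_subset[of "f y - f x" "(f y - f z) \<union> (f z - f x)"] by blast
qed

text \<open>Equicardinality of bases in relative form: an exchange removes one element from each of
  the two differences.\<close>

lemma card_diff_commute:
  assumes "x \<in> V" "y \<in> V"
  shows "card (f x - f y) = card (f y - f x)"
  using assms(1)
proof (induction "card (f x - f y)" arbitrary: x)
  case 0
  then have x: "f x - f y = {}" using finite_diff[OF 0(2) assms(2)] by simp
  \<comment> \<open>An exchange starting from \<open>y\<close> would have to take its new element
    from the empty set \<open>f x - f y\<close>.\<close>
  then have y: "f y - f x = {}" using exchange[OF assms(2) 0(2)] by blast
  show ?case unfolding x y by (rule refl)
next
  case (Suc n)
  then obtain i where i: "i \<in> f x - f y" by (metis card.empty ex_in_conv nat.distinct(1))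
  obtain j z where z: "j \<in> f y - f x" "z \<in> V" "f z = insert j (f x - {i})"
    using exchange[OF Suc(3) assms(2) i] by blast
  have "f x - f y = insert i (f z - f y)" "i \<notin> f z - f y"
    "f y - f x = insert j (f y - f z)" "j \<notin> f y - f z" using i z(1) unfolding z(3) by auto
  then show ?case
    using Suc(1)[of z] Suc(2) z(2) finite_diff[OF z(2) assms(2)] by simp
qed

lemma graph_metric_card: "graph_metric V (\<lambda>x y. card (f x - f y))"
proof
  show "card (f x - f y) = 0 \<longleftrightarrow> x = y" if V: "x \<in> V" "y \<in> V" for x y
  proof -
    have "card (f x - f y) = 0 \<longleftrightarrow> f x - f y = {} \<and> f y - f x = {}"
      using finite_diff[OF V] card_diff_commute[OF V] by (metis card_eq_0_iff)
    also have "\<dots> \<longleftrightarrow> f x = f y" by blast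
    finally show ?thesis using inj_on_eq_iff[OF inj V] by simp
  qed
  show "card (f x - f y) = card (f y - f x)" if "x \<in> V" "y \<in> V" for x y
    using card_diff_commute that .
  show "card (f x - f z) \<le> card (f x - f y) + card (f y - f z)" if "x \<in> V" "y \<in> V" "z \<in> V" for x y z
  proof -
    have "card (f x - f z) \<le> card ((f x - f y) \<union> (f y - f z))"
      using finite_diff that by (intro card_mono) auto
    then show ?thesis using card_Un_le order_trans by blast
  qed
  show "\<exists>z\<in>V. card (f x - f z) = 1 \<and> card (f z - f y) = n"
    if V: "x \<in> V" "y \<in> V" and n: "card (f x - f y) = Suc n" for x y n
  proof -
    obtain i where i: "i \<in> f x - f y" using n by (metis card.empty ex_in_conv nat.distinct(1))
    obtain j z where z: "j \<in> f y - f x" "z \<in> V" "f z = insert j (f x - {i})"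
      using exchange[OF V i] by blast
    have "f x - f z = {i}" "f z - f y = (f x - f y) - {i}" using i z(1) unfolding z(3) by auto
    then show ?thesis using i n z(2) by (intro bexI[of _ z]) auto
  qed
qed

lemma dist_card:
  assumes "x \<in> V" "y \<in> V"
  shows "d x y = card (f x - f y)"
proof (rule graph_metric_unique[OF graph_metric_card _ assms])
  fix x y assume V: "x \<in> V" "y \<in> V"
  have "card ((f x - f y) \<union> (f y - f x)) = 2 * card (f x - f y)"
    using finite_diff[OF V] card_diff_commute[OF V] by (subst card_Un_disjoint) auto
  then show "card (f x - f y) = 1 \<longleftrightarrow> d x y = 1" using dist_1_iff[OF V] by auto
qed

text \<open>\<open>f x - f y\<close> is contained in the disjoint union of \<open>f x - f z\<close>
  and \<open>f z - f y\<close>, so the cardinalities add up exactly when this inclusion is an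
  equality.\<close>

lemma between_iff:
  assumes V: "x \<in> V" "y \<in> V" "z \<in> V"
  shows "d x z + d z y = d x y \<longleftrightarrow> f x \<inter> f y \<subseteq> f z \<and> f z \<subseteq> f x \<union> f y"
proof -
  have fin: "finite (f x - f z)" "finite (f z - f y)" "finite (f x - f y)" using finite_diff V by auto
  have "card (f x - f z) + card (f z - f y) =
      card ((f x - f z) \<union> (f z - f y))"
    using fin by (subst card_Un_disjoint) auto
  moreover have "f x - f y \<subseteq> (f x - f z) \<union> (f z - f y)" by blast
  ultimately have "d x z + d z y = d x y \<longleftrightarrow> f x - f y = (f x - f z) \<union> (f z - f y)"
    using card_seteq[of "(f x - f z) \<union> (f z - f y)" "f x - f y"] fin dist_card V by auto
  also have "\<dots> \<longleftrightarrow> f x \<inter> f y \<subseteq> f z \<and> f z \<subseteq> f x \<union> f y" by blast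
  finally show ?thesis .
qed

lemma convex_containing: "convex {x \<in> V. i \<in> f x}"
  unfolding convex_def using between_iff by blast

lemma convex_avoiding: "convex {x \<in> V. i \<notin> f x}"
  unfolding convex_def using between_iff by blast

lemma edge_elements:
  assumes "edge u v"
  obtains i j where "f u - f v = {i}" "f v - f u = {j}"
proof -
  have "card (f u - f v) = 1" "card (f v - f u) = 1"
    using assms dist_card edgeD by metis+
  then show thesis using that by (auto simp: card_1_singleton_iff)
qed

text \<open>With the common part of \<open>f u\<close> and \<open>f v\<close> removed from
  \<open>f x\<close>, the two distances are the sizes of one finite set \<open>Y\<close> without
  \<open>i\<close> and without \<open>j\<close>.\<close>

lemma dist_edge_cases:
  assumes "edge u v" "f u - f v = {i}" "f v - f u = {j}" "x \<in> V"
  shows "d x u < d x v \<longleftrightarrow> i \<in> f x \<and> j \<notin> f x" "d x u = d x v \<longleftrightarrow> (i \<in> f x \<longleftrightarrow> j \<in> f x)"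
proof -
  define Y where "Y = f x - f u \<inter> f v"
  note V = edgeD(1,2)[OF assms(1)]
  have ij: "i \<in> f u" "i \<notin> f v" "j \<in> f v" "j \<notin> f u" using assms(2,3) by blast+
  have "f x - f u = Y - {i}" "f x - f v = Y - {j}" using assms(2,3) unfolding Y_def by blast+
  then have d: "d x u = card (Y - {i})" "d x v = card (Y - {j})" using dist_card assms(4) V by simp_all
  have Y: "i \<in> Y \<longleftrightarrow> i \<in> f x" "j \<in> Y \<longleftrightarrow> j \<in> f x" using ij by (auto simp: Y_def)
  have "Y \<subseteq> insert i (f x - f u)" using assms(2) unfolding Y_def by blast
  then have "finite Y" using finite_diff[OF assms(4) V(1)] finite_subset by blast
  moreover have "i \<in> Y \<Longrightarrow> card Y > 0" "j \<in> Y \<Longrightarrow> card Y > 0" using \<open>finite Y\<close> card_gt_0_iff by blast+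
  ultimately show "d x u < d x v \<longleftrightarrow> i \<in> f x \<and> j \<notin> f x"
    "d x u = d x v \<longleftrightarrow> (i \<in> f x \<longleftrightarrow> j \<in> f x)"
    unfolding d Y[symmetric] by (auto simp: card_Diff_singleton_if)
qed

text \<open>Every vertex of a geodesic has its label between intersection and union of the end
  labels, hence lies in \<open>S\<close>.\<close>

lemma connected_between:
  assumes "x \<in> V" "y \<in> V" and S: "\<And>z. \<lbrakk>z \<in> V; f x \<inter> f y \<subseteq> f z; f z \<subseteq> f x \<union> f y\<rbrakk> \<Longrightarrow> z \<in> S"
  shows "(\<lambda>a b. edge a b \<and> a \<in> S \<and> b \<in> S)\<^sup>*\<^sup>* x y"
  using assms(1) S
proof (induction "d x y" arbitrary: x)
  case 0
  then show ?case using dist_0[of x y] assms(2) by auto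
next
  case (Suc n)
  obtain z where z: "edge x z" "z \<in> V" "d z y = n" using edge_towards[of x y n] Suc assms(2) by metis
  have "d x z + d z y = d x y" using z Suc(2) edgeD[OF z(1)] by simp
  then have b: "f x \<inter> f y \<subseteq> f z" "f z \<subseteq> f x \<union> f y" using between_iff[OF Suc(3) assms(2) z(2)] by auto
  then have "z \<in> S" "x \<in> S" using Suc(3,4) z(2) by blast+
  moreover have "(\<lambda>a b. edge a b \<and> a \<in> S \<and> b \<in> S)\<^sup>*\<^sup>* z y"
  proof (rule Suc(1))
    fix w assume "w \<in> V" "f z \<inter> f y \<subseteq> f w" "f w \<subseteq> f z \<union> f y"
    then show "w \<in> S" using Suc(4)[of w] b by blast
  qed (use z in auto)
  ultimately show ?case using z(1) by (intro converse_rtranclp_into_rtranclp[of _ x z]) auto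
qed

text \<open>The existence of two opposite corners in the interval; the names \<open>c\<close> and
  \<open>e\<close> are assigned so that these are the labels with \<open>{a, c}\<close> and
  \<open>{b, e}\<close>.\<close>

lemma square_elements:
  assumes V: "x \<in> V" "y \<in> V" and 2: "d x y = 2"
  obtains a b c e where "f x - f y = {a, b}" "f y - f x = {c, e}" "a \<noteq> b" "c \<noteq> e"
    "\<exists>z\<in>V. f z = f x \<inter> f y \<union> {a, c}" "\<exists>z\<in>V. f z = f x \<inter> f y \<union> {b, e}"
proof -
  have "card (f x - f y) = 2" "card (f y - f x) = 2" using dist_card 2 dist_commute V by metis+
  then obtain a b c e where ab: "f x - f y = {a, b}" "a \<noteq> b" and ce: "f y - f x = {c, e}" "c \<noteq> e"
    by (auto simp: card_2_iff)
  define P where "P p q \<longleftrightarrow> (\<exists>z\<in>V. f z = f x \<inter> f y \<union> {p, q})" for p q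
  have x: "P q c \<or> P q e" if "{p, q} = {a, b}" for p q
  proof -
    have "p \<in> f x - f y" using that ab(1) by blast
    then obtain j z where z: "j \<in> f y - f x" "z \<in> V" "f z = insert j (f x - {p})"
      using exchange[OF V] by blast
    have "p \<noteq> q" using that ab by auto
    have "f x = f x \<inter> f y \<union> {p, q}" unfolding that ab(1)[symmetric] by blast
    moreover have "p \<notin> f x \<inter> f y" using \<open>p \<in> f x - f y\<close> by blast
    ultimately have "f z = f x \<inter> f y \<union> {q, j}" using z(3) \<open>p \<noteq> q\<close> by blast
    then show ?thesis using z(1,2) ce(1) unfolding P_def by auto
  qed
  have y: "P a q \<or> P b q" if "{p, q} = {c, e}" for p q
  proof -
    have "p \<in> f y - f x" using that ce(1) by blast
    then obtain j z where z: "j \<in> f x - f y" "z \<in> V" "f z = insert j (f y - {p})"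
      using exchange[OF V(2,1)] by blast
    have "p \<noteq> q" using that ce by auto
    have "f y = f x \<inter> f y \<union> {p, q}" unfolding that ce(1)[symmetric] by blast
    moreover have "p \<notin> f x \<inter> f y" using \<open>p \<in> f y - f x\<close> by blast
    ultimately have "f z = f x \<inter> f y \<union> {j, q}" using z(3) \<open>p \<noteq> q\<close> by blast
    then show ?thesis using z(1,2) ab(1) unfolding P_def by auto
  qed
  \<comment> \<open>Exchange puts an entry into every row and every column of the 2 by 2 table of
    \<open>P\<close>, so one of its diagonals is full.\<close>
  have "P a c \<and> P b e \<or> P a e \<and> P b c"
    using x[of a b] x[of b a] y[of c e] y[of e c] by (auto simp: insert_commute)
  then show thesis
  proof
    assume "P a c \<and> P b e"
    then show thesis using that[OF ab(1) ce(1) ab(2) ce(2)] unfolding P_def by blast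
  next
    assume "P a e \<and> P b c"
    moreover have "f y - f x = {e, c}" using ce(1) by blast
    ultimately show thesis using that[OF ab(1) _ ab(2)] ce(2) unfolding P_def by blast
  qed
qed

end

section \<open>Verification of the two conditions for basis graphs\<close>

lemma component_eqI:
  assumes "simple_graph K" "x \<in> C" "C \<subseteq> verts K"
    and closed: "\<And>y z. \<lbrakk>y \<in> C; adj K y z\<rbrakk> \<Longrightarrow> z \<in> C"
    and conn: "\<And>y. y \<in> C \<Longrightarrow> (adj K)\<^sup>*\<^sup>* x y"
  shows "{y. \<exists>p. gpath K x p y} = C"
proof -
  have "y \<in> C" if "(adj K)\<^sup>*\<^sup>* x y" for y
    using that by induction (use assms(2) closed in auto)
  moreover have "(\<exists>p. gpath K x p y) \<longleftrightarrow> (adj K)\<^sup>*\<^sup>* x y" for y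
    using gpath_iff_rtranclp[OF assms(1)] assms(2,3) by blast
  ultimately show ?thesis using conn by blast
qed

locale exchange_ugraph = exchange_graph "verts G" "gdist G" f for G :: "'a ugraph" and f :: "'a \<Rightarrow> 'b set" +
  assumes simple: "simple_graph G" and connected: "connected_graph G"
begin

lemma edge_iff_adj: "edge u v \<longleftrightarrow> adj G u v"
  using gdist_1[OF simple connected] simple_graph_adj[OF simple] by (auto simp: edge_def)

text \<open>The vertices whose labels include \<open>D\<close> and avoid \<open>E\<close> form an
  interval-closed set, hence a connected one by \<open>connected_between\<close>; being closed under
  adjacency in \<open>S\<close>, it is a whole component.\<close>

lemma component_cell:
  assumes cell: "C = {x \<in> verts G. D \<subseteq> f x \<and> E \<inter> f x = {}}" and "C \<subseteq> S" "x \<in> C"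
    and closed: "\<And>y z. \<lbrakk>y \<in> C; z \<in> S; adj G y z\<rbrakk> \<Longrightarrow> z \<in> C"
  shows "{y. \<exists>p. gpath (induced_subgraph G S) x p y} = C"
proof (rule component_eqI[OF simple_induced[OF simple] assms(3)])
  show "C \<subseteq> verts (induced_subgraph G S)" using cell assms(2) by (auto simp: verts_induced)
  show "z \<in> C" if "y \<in> C" "adj (induced_subgraph G S) y z" for y z
    using closed that by (auto simp: adj_induced)
  show "(adj (induced_subgraph G S))\<^sup>*\<^sup>* x y" if y: "y \<in> C" for y
  proof -
    have "(\<lambda>a b. edge a b \<and> a \<in> C \<and> b \<in> C)\<^sup>*\<^sup>* x y"
    proof (rule connected_between)
      fix z assume "z \<in> verts G" "f x \<inter> f y \<subseteq> f z" "f z \<subseteq> f x \<union> f y"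
      then show "z \<in> C" using y assms(3) unfolding cell by blast
    qed (use y assms(3) cell in auto)
    then show ?thesis
      by (rule rtranclp_mono[THEN predicate2D, rotated])
        (use assms(2) in \<open>auto simp: adj_induced edge_iff_adj\<close>)
  qed
qed

lemma wall_condition: "wall_condition G"
  unfolding wall_condition_def
proof (intro ballI impI)
  fix u v assume "adj G u v"
  then have uv: "edge u v" by (simp add: edge_iff_adj)
  obtain i j where ij: "f u - f v = {i}" "f v - f u = {j}" using edge_elements[OF uv] .
  \<comment> \<open>Both sets are written in the form of a cell with required and forbidden
    elements, as \<open>component_cell\<close> expects.\<close>
  define P where "P = {x \<in> verts G. {i, j} \<subseteq> f x \<and> {} \<inter> f x = {}}"
  define Q where "Q = {x \<in> verts G. {} \<subseteq> f x \<and> {i, j} \<inter> f x = {}}"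
  define S where "S = W_eq G u v"
  have vu: "edge v u" using uv edge_sym by blast
  note cases = dist_edge_cases[OF uv ij] dist_edge_cases[OF vu ij(2,1)]
  have S: "S = P \<union> Q" using cases by (auto simp: S_def W_eq_def P_def Q_def)
  have PQ: "P \<inter> Q = {}" by (auto simp: P_def Q_def)
  have "i \<noteq> j" using ij by auto
  have no_edge: False if x: "x \<in> P" and y: "y \<in> Q" and xy: "adj G x y" for x y
  proof -
    have "edge x y" using xy by (simp add: edge_iff_adj)
    then obtain i' where "f x - f y = {i'}" using edge_elements by blast
    moreover have "i \<in> f x - f y" "j \<in> f x - f y" using x y by (auto simp: P_def Q_def)
    ultimately show False using \<open>i \<noteq> j\<close> by simp
  qed
  have compP: "{y. \<exists>p. gpath (induced_subgraph G S) x p y} = P" if "x \<in> P" for x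
    using no_edge S by (intro component_cell[OF P_def _ that]) blast+
  have compQ: "{y. \<exists>p. gpath (induced_subgraph G S) x p y} = Q" if "x \<in> Q" for x
    using no_edge S adj_commute[of G] by (intro component_cell[OF Q_def _ that]) blast+
  have "verts (induced_subgraph G S) = P \<union> Q"
    by (auto simp: verts_induced S P_def Q_def)
  then have "component_sets (induced_subgraph G S) = (\<lambda>x. P) ` P \<union> (\<lambda>x. Q) ` Q"
    by (simp add: component_sets_def image_Un compP compQ cong: image_cong)
  also have "\<dots> = {P, Q} - {{}}" by auto
  finally have comps: "two_components G S P Q" using PQ by (simp add: two_components_def)
  have less: "W_less G u v = {x \<in> verts G. i \<in> f x \<and> j \<notin> f x}"
    "W_less G v u = {x \<in> verts G. j \<in> f x \<and> i \<notin> f x}"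
    using cases by (auto simp: W_less_def)
  have sides: "W_less G u v \<union> P = {x \<in> verts G. i \<in> f x}" "W_less G v u \<union> Q = {x \<in> verts G. i \<notin> f x}"
    "W_less G u v \<union> Q = {x \<in> verts G. j \<notin> f x}" "W_less G v u \<union> P = {x \<in> verts G. j \<in> f x}"
    by (auto simp: less P_def Q_def)
  have convex_iff: "gconvex G A \<longleftrightarrow> convex A" for A
    unfolding gconvex_def convex_def ginterval_def by blast
  have "complementary_halfspaces G {x \<in> verts G. i \<in> f x} {x \<in> verts G. i \<notin> f x}"
    "complementary_halfspaces G {x \<in> verts G. j \<notin> f x} {x \<in> verts G. j \<in> f x}"
    using convex_containing convex_avoiding unfolding complementary_halfspaces_def convex_iff by auto
  then show "\<exists>C1 C2. two_components G (W_eq G u v) C1 C2 \<and>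
      complementary_halfspaces G (W_less G u v \<union> C1) (W_less G v u \<union> C2) \<and>
      complementary_halfspaces G (W_less G u v \<union> C2) (W_less G v u \<union> C1)"
    using comps sides unfolding S_def by metis
qed

text \<open>All labels are a common set \<open>C\<close> plus a small set \<open>ps ! k\<close>, so
  adjacency depends on the small sets alone and the isomorphism becomes a finite
  computation.\<close>

lemma induced_iso:
  assumes I: "I \<subseteq> verts G" and xs: "set xs = I" "length ps = length xs"
    and f: "\<And>k. k < length xs \<Longrightarrow> f (xs ! k) = C \<union> ps ! k"
    and ps: "distinct ps" "\<And>p. p \<in> set ps \<Longrightarrow> p \<inter> C = {}"
    and K: "verts K = {0..<length ps}"
      "\<forall>k<length ps. \<forall>l<length ps. adj K k l \<longleftrightarrow> card (ps ! k - ps ! l) = 1"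
  shows "graph_iso (induced_subgraph G I) K"
proof (rule graph_iso_of_list)
  have disj: "ps ! k \<inter> C = {}" if "k < length xs" for k using ps(2) that xs(2) by auto
  show "distinct xs"
  proof (unfold distinct_conv_nth, intro allI impI notI)
    fix k l assume kl: "k < length xs" "l < length xs" "k \<noteq> l" "xs ! k = xs ! l"
    then have "C \<union> ps ! k = C \<union> ps ! l" using f by metis
    then have "ps ! k = ps ! l" using disj[OF kl(1)] disj[OF kl(2)] by blast
    then show False using ps(1) kl xs(2) by (auto simp: nth_eq_iff_index_eq)
  qed
  show "set xs = verts (induced_subgraph G I)" using I xs by (auto simp: verts_induced)
  show "verts K = {0..<length xs}" using K xs by simp
  fix k l assume kl: "k < length xs" "l < length xs"
  then have V: "xs ! k \<in> verts G" "xs ! l \<in> verts G" "xs ! k \<in> I" "xs ! l \<in> I" using I xs by auto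
  have "f (xs ! k) - f (xs ! l) = ps ! k - ps ! l" using disj[OF kl(1)] unfolding f[OF kl(1)] f[OF kl(2)] by blast
  then have "adj (induced_subgraph G I) (xs ! k) (xs ! l) \<longleftrightarrow> card (ps ! k - ps ! l) = 1"
    using V dist_card[OF V(1,2)] gdist_1[OF simple connected V(1,2)] by (simp add: adj_induced)
  then show "adj (induced_subgraph G I) (xs ! k) (xs ! l) \<longleftrightarrow> adj K k l" using K(2) kl xs(2) by simp
qed

lemma interval_condition: "interval_condition G"
  unfolding interval_condition_def
proof (intro ballI impI)
  fix u v assume V: "u \<in> verts G" "v \<in> verts G" and 2: "gdist G u v = 2"
  obtain a b c e where fu: "f u - f v = {a, b}" and fv: "f v - f u = {c, e}" and ne: "a \<noteq> b" "c \<noteq> e"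
    and ex: "\<exists>z\<in>verts G. f z = f u \<inter> f v \<union> {a, c}" "\<exists>z\<in>verts G. f z = f u \<inter> f v \<union> {b, e}"
    using square_elements[OF V 2] .
  define C where "C = f u \<inter> f v"
  have notC: "a \<notin> C" "b \<notin> C" "c \<notin> C" "e \<notin> C" using fu fv by (auto simp: C_def)
  have ne': "a \<noteq> c" "a \<noteq> e" "b \<noteq> c" "b \<noteq> e" using fu fv by auto
  note neq = ne ne' ne[symmetric] ne'[symmetric]
  have fuC: "f u = C \<union> {a, b}" unfolding C_def fu[symmetric] by blast
  have fvC: "f v = C \<union> {c, e}" unfolding C_def fv[symmetric] by blast
  have fu_fv: "f u \<union> f v = C \<union> {a, b, c, e}" unfolding fuC fvC by blast
  define I where "I = ginterval G u v"
  have IV: "I \<subseteq> verts G" by (auto simp: I_def ginterval_def)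
  \<comment> \<open>As labels are injective, \<open>L p\<close> is a singleton or empty, according
    to whether \<open>C \<union> p\<close> is a label.\<close>
  define L where "L p = {z \<in> verts G. f z = C \<union> p}" for p
  have L_eq: "L p = {z}" if "z \<in> verts G" "f z = C \<union> p" for z p
    using that by (auto simp: L_def intro: inj_onD[OF inj])
  have I: "I = L {a, b} \<union> L {c, e} \<union> L {a, c} \<union> L {b, e} \<union> L {a, e} \<union> L {b, c}"
  proof (intro equalityI subsetI)
    fix z assume z: "z \<in> I"
    then have zV: "z \<in> verts G" and "gdist G u z + gdist G z v = gdist G u v"
      by (auto simp: I_def ginterval_def)
    then have "C \<subseteq> f z" "f z \<subseteq> C \<union> {a, b, c, e}"
      using between_iff[OF V zV] unfolding C_def[symmetric] fu_fv by simp_all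
    then have fz: "f z = C \<union> (f z \<inter> {a, b, c, e})" by blast
    have "card (f u - f z) = card (f z - f u)" using card_diff_commute[OF V(1) zV] .
    moreover have "f u - f z = {a, b} - f z" "f z - f u = {c, e} \<inter> f z"
      using \<open>C \<subseteq> f z\<close> \<open>f z \<subseteq> _\<close> notC neq unfolding fuC by blast+
    ultimately have "card ({a, b} - f z) = card ({c, e} \<inter> f z)" by simp
    then have p: "f z \<inter> {a, b, c, e} \<in> {{a, b}, {c, e}, {a, c}, {b, e}, {a, e}, {b, c}}"
      using neq by (cases "a \<in> f z"; cases "b \<in> f z"; cases "c \<in> f z"; cases "e \<in> f z")
        (simp_all add: Int_insert_right insert_Diff_if)
    then show "z \<in> L {a, b} \<union> L {c, e} \<union> L {a, c} \<union> L {b, e} \<union> L {a, e} \<union> L {b, c}"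
    proof -
      have "z \<in> L (f z \<inter> {a, b, c, e})" unfolding L_def using zV fz by blast
      then show ?thesis using p by auto
    qed
  next
    fix z assume "z \<in> L {a, b} \<union> L {c, e} \<union> L {a, c} \<union> L {b, e} \<union> L {a, e} \<union> L {b, c}"
    then have zV: "z \<in> verts G" and "C \<subseteq> f z" "f z \<subseteq> C \<union> {a, b, c, e}"
      unfolding L_def by auto
    then have "gdist G u z + gdist G z v = gdist G u v"
      using between_iff[OF V zV] unfolding C_def[symmetric] fu_fv by simp
    then show "z \<in> I" using zV by (simp add: I_def ginterval_def)
  qed
  obtain w x where w: "w \<in> verts G" "f w = C \<union> {a, c}" and x: "x \<in> verts G" "f x = C \<union> {b, e}"
    using ex[folded C_def] by blast
  have L: "L {a, b} = {u}" "L {c, e} = {v}" "L {a, c} = {w}" "L {b, e} = {x}"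
    using L_eq[OF V(1) fuC] L_eq[OF V(2) fvC] L_eq[OF w] L_eq[OF x] .
  note simps = All_less_Suc neq notC numeral_eq_Suc insert_Diff_if card_insert_if doubleton_eq_iff
  \<comment> \<open>The corners \<open>u\<close>, \<open>w\<close>, \<open>v\<close>,
    \<open>x\<close> always exist and form a square. Only the labels with \<open>{a, e}\<close> and
    \<open>{b, c}\<close> may be missing; each of them, if present, is adjacent to all four
    corners.\<close>
  consider (square) "L {a, e} = {}" "L {b, c} = {}"
    | (pyramid1) y where "f y = C \<union> {a, e}" "L {a, e} = {y}" "L {b, c} = {}"
    | (pyramid2) y where "f y = C \<union> {b, c}" "L {b, c} = {y}" "L {a, e} = {}"
    | (octahedron) y z where "f y = C \<union> {a, e}" "L {a, e} = {y}" "f z = C \<union> {b, c}" "L {b, c} = {z}"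
  proof -
    have "L p = {} \<or> (\<exists>y. f y = C \<union> p \<and> L p = {y})" for p
      using L_eq unfolding L_def by blast
    then show thesis using that by metis
  qed
  then have "graph_iso (induced_subgraph G I) square_graph \<or> graph_iso (induced_subgraph G I) pyramid_graph \<or>
      graph_iso (induced_subgraph G I) octahedron_graph"
  proof cases
    case square
    have "graph_iso (induced_subgraph G I) square_graph"
      by (rule induced_iso[OF IV, of "[u, w, v, x]" "[{a, b}, {a, c}, {c, e}, {b, e}]" C])
        (use square I L fuC fvC w x in \<open>auto simp: simps less_Suc_eq adj_square verts_small_upt\<close>)
    then show ?thesis by blast
  next
    case pyramid1
    have "graph_iso (induced_subgraph G I) pyramid_graph"
      by (rule induced_iso[OF IV, of "[u, w, v, x, y]" "[{a, b}, {a, c}, {c, e}, {b, e}, {a, e}]" C])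
        (use pyramid1 I L fuC fvC w x in \<open>auto simp: simps less_Suc_eq adj_pyramid verts_small_upt\<close>)
    then show ?thesis by blast
  next
    case pyramid2
    have "graph_iso (induced_subgraph G I) pyramid_graph"
      by (rule induced_iso[OF IV, of "[u, w, v, x, y]" "[{a, b}, {a, c}, {c, e}, {b, e}, {b, c}]" C])
        (use pyramid2 I L fuC fvC w x in \<open>auto simp: simps less_Suc_eq adj_pyramid verts_small_upt\<close>)
    then show ?thesis by blast
  next
    case octahedron
    \<comment> \<open>Complementary pairs are listed consecutively, to match the missing edges of
      \<open>octahedron_graph\<close>.\<close>
    have "graph_iso (induced_subgraph G I) octahedron_graph"
      by (rule induced_iso[OF IV, of "[u, v, w, x, y, z]"
            "[{a, b}, {c, e}, {a, c}, {b, e}, {a, e}, {b, c}]" C])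
        (use octahedron I L fuC fvC w x in
          \<open>auto simp: simps less_Suc_eq adj_octahedron verts_small_upt\<close>)
    then show ?thesis by blast
  qed
  then show "let H = induced_subgraph G (ginterval G u v)
      in graph_iso H square_graph \<or> graph_iso H pyramid_graph \<or> graph_iso H octahedron_graph"
    by (simp add: I_def Let_def)
qed

end

section \<open>The two directions of the characterisation\<close>

lemma adj_basis_graph:
  "adj (basis_graph \<B>) A B \<longleftrightarrow> A \<in> \<B> \<and> B \<in> \<B> \<and> card ((A - B) \<union> (B - A)) = 2"
  by (auto simp: adj_def basis_graph_def doubleton_eq_iff Un_commute)

lemma conditions_of_basis_graph:
  assumes G: "simple_graph G" "connected_graph G"
    and matroid: "matroid \<Lambda> \<B>" and iso: "graph_iso G (basis_graph \<B>)"
  shows "wall_condition G \<and> interval_condition G"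
proof -
  obtain f where bij: "bij_betw f (verts G) \<B>"
    and adj: "\<And>x y. \<lbrakk>x \<in> verts G; y \<in> verts G\<rbrakk> \<Longrightarrow> adj G x y \<longleftrightarrow> adj (basis_graph \<B>) (f x) (f y)"
    using iso by (auto simp: graph_iso_def basis_graph_def)
  have f: "f ` verts G = \<B>" "inj_on f (verts G)" using bij by (auto simp: bij_betw_def)
  interpret exchange_ugraph G f
  proof (intro exchange_ugraph.intro exchange_graph.intro exchange_graph_axioms.intro
      exchange_ugraph_axioms.intro gdist_graph_metric G f(2))
    fix x y assume V: "x \<in> verts G" "y \<in> verts G"
    then have fB: "f x \<in> \<B>" "f y \<in> \<B>" using f(1) by blast+
    show "gdist G x y = 1 \<longleftrightarrow> card ((f x - f y) \<union> (f y - f x)) = 2"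
      unfolding gdist_1[OF G V] adj[OF V] adj_basis_graph using fB by simp
    fix i assume "i \<in> f x - f y"
    then obtain j where j: "j \<in> f y - f x" "(f x - {i}) \<union> {j} \<in> \<B>"
      using matroid fB unfolding matroid_def by blast
    then have "insert j (f x - {i}) \<in> f ` verts G" unfolding f(1) by simp
    then obtain z where "z \<in> verts G" "f z = insert j (f x - {i})" by (metis imageE)
    then show "\<exists>j\<in>f y - f x. \<exists>z\<in>verts G. f z = insert j (f x - {i})" using j(1) by blast
  qed
  show ?thesis using wall_condition interval_condition by blast
qed

text \<open>The bound on the ground set by halves of walls, embedded with \<open>Inr\<close>, makes
  it finite when the graph is finite.\<close>

lemma basis_graph_of_conditions:
  assumes G: "simple_graph G" "connected_graph G"
    and WC: "wall_condition G" and IC: "interval_condition G"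
  shows "\<exists>(\<Lambda> :: ('b + 'a set) set) \<B>. \<Lambda> \<subseteq> Inr ` Pow (verts G) \<and> matroid \<Lambda> \<B> \<and>
    graph_iso (G :: 'a ugraph) (basis_graph \<B>)"
proof -
  interpret walled_graph "verts G" "gdist G" "edge_walls G"
    using walled_graph_of_conditions[OF assms] .
  obtain \<Lambda> where \<Lambda>: "oriented_walls (verts G) (gdist G) (edge_walls G) \<Lambda>"
    "\<And>u v. edge u v \<Longrightarrow> oriented_walls.oriented (edge_walls G) \<Lambda> u v"
    using oriented_walls_exist by blast
  interpret coherent_walls "verts G" "gdist G" "edge_walls G" \<Lambda>
    using \<Lambda> by (intro coherent_walls.intro coherent_walls_axioms.intro)
  define \<phi> :: "'a \<Rightarrow> ('b + 'a set) set" where "\<phi> v = Inr ` basis v" for v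
  have \<phi>_diff: "\<phi> u - \<phi> v = Inr ` (basis u - basis v)" for u v
    unfolding \<phi>_def by (simp add: image_set_diff)
  have "inj_on \<phi> (verts G)"
    using basis_inj unfolding \<phi>_def inj_on_def by (simp add: inj_image_eq_iff)
  then have bij: "bij_betw \<phi> (verts G) (\<phi> ` verts G)" by (simp add: bij_betw_def)
  have "adj G u v \<longleftrightarrow> adj (basis_graph (\<phi> ` verts G)) (\<phi> u) (\<phi> v)"
    if V: "u \<in> verts G" "v \<in> verts G" for u v
  proof -
    have "(\<phi> u - \<phi> v) \<union> (\<phi> v - \<phi> u) = Inr ` ((basis u - basis v) \<union> (basis v - basis u))"
      unfolding \<phi>_diff by blast
    then have "card ((\<phi> u - \<phi> v) \<union> (\<phi> v - \<phi> u)) = 2 \<longleftrightarrow> gdist G u v = 1"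
      using basis_adjacent[OF V] by (simp add: card_image)
    then show ?thesis using V gdist_1[OF G V] by (simp add: adj_basis_graph)
  qed
  then have "graph_iso G (basis_graph (\<phi> ` verts G))"
    using bij unfolding graph_iso_def by (auto simp: basis_graph_def)
  moreover have "matroid (Inr ` \<Lambda>) (\<phi> ` verts G)"
    unfolding matroid_def
  proof (intro conjI ballI)
    show "\<phi> ` verts G \<subseteq> Pow (Inr ` \<Lambda>)" by (auto simp: \<phi>_def basis_def)
    fix A B i assume "A \<in> \<phi> ` verts G" "B \<in> \<phi> ` verts G" "i \<in> A - B"
    then obtain u v where uv: "u \<in> verts G" "v \<in> verts G" "A = \<phi> u" "B = \<phi> v" by blast
    then obtain H where H: "H \<in> basis u - basis v" "i = Inr H"
      using \<open>i \<in> A - B\<close> \<phi>_diff by auto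
    obtain K w where K: "K \<in> basis v - basis u" "w \<in> verts G" "basis w = (basis u - {H}) \<union> {K}"
      using basis_exchange[OF uv(1,2) H(1)] by blast
    have "Inr K \<in> B - A" unfolding uv \<phi>_diff using K(1) by blast
    moreover have "(A - {i}) \<union> {Inr K} = \<phi> w"
      unfolding uv(3) H(2) \<phi>_def K(3) by (auto simp: image_iff)
    ultimately show "\<exists>j\<in>B - A. (A - {i}) \<union> {j} \<in> \<phi> ` verts G" using K(2) by auto
  qed
  moreover have "(Inr ` \<Lambda> :: ('b + 'a set) set) \<subseteq> Inr ` Pow (verts G)"
    using \<Lambda>_walls all_walls_subset by blast
  ultimately show ?thesis by blast
qed

theorem corollary1:
  fixes G :: "'a ugraph"
  assumes "simple_graph G" and "connected_graph G"
  shows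
    "((\<exists>(\<Lambda> :: ('b + 'a set) set) \<B>. matroid \<Lambda> \<B> \<and> graph_iso G (basis_graph \<B>))
        \<longleftrightarrow> wall_condition G \<and> interval_condition G)
     \<and>
     (finite (verts G) \<longrightarrow>
       ((\<exists>(\<Lambda> :: ('b + 'a set) set) \<B>. finite \<Lambda> \<and> matroid \<Lambda> \<B> \<and> graph_iso G (basis_graph \<B>))
        \<longleftrightarrow> wall_condition G \<and> interval_condition G))"
proof -
  have necessary: "wall_condition G \<and> interval_condition G"
    if "matroid \<Lambda> \<B>" "graph_iso G (basis_graph \<B>)" for \<Lambda> :: "('b + 'a set) set" and \<B>
    using conditions_of_basis_graph assms that by blast
  have sufficient: "\<exists>(\<Lambda> :: ('b + 'a set) set) \<B>. \<Lambda> \<subseteq> Inr ` Pow (verts G) \<and> matroid \<Lambda> \<B> \<and>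
      graph_iso G (basis_graph \<B>)" if "wall_condition G \<and> interval_condition G"
    using basis_graph_of_conditions assms that by blast
  have finite: "finite \<Lambda>" if "finite (verts G)" "\<Lambda> \<subseteq> Inr ` Pow (verts G)" for \<Lambda> :: "('b + 'a set) set"
    using that finite_subset by blast
  show ?thesis using necessary sufficient finite by meson
qed

end
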